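(* Let $\vartheta$ be a compatible, irreducible Pisot random substitution on $\mathcal A=\{1,\dots,d\}$. The subtiles $(\mathcal R_{\vartheta,a})_{a\in\mathcal A}$ form the unique family of non-empty compact subsets of $\mathbb H$ satisfying, for every $a\in\mathcal A$, the self-consistency relation $$\mathcal R_{\vartheta,a}=\bigcup_{b\in\mathcal A}\ \bigcup_{\substack{(p,a,s)\in\mathcal P_\vartheta\\ pas\in\vartheta(b)}} \bigl(h(\mathcal R_{\vartheta,b})+\pi(\psi(p))\bigr).$$
   Context: Let $\mathcal A^+$ be the set of non-empty finite words over $\mathcal A$, $\mathcal A^*=\mathcal A^+\cup\{\varepsilon\}$ with $\varepsilon$ the empty word, $|u|_i$ the number of occurrences of $i$ in $u$, $\psi(u)=(|u|_1,\dots,|u|_d)^T$, and $x_{[1,n]}=x_1\cdots x_n$ (empty if $n=0$). $S$ is the left shift on $\mathcal A^{\mathbb N}$ (product topology); the shift-orbit of $x$ is $\{S^n x:n\ge 0\}$. Random substitution (set-valued part): a map $\vartheta$ assigning to each letter a non-empty finite subset of $\mathcal A^+$ (the probabilities attached to realisations play no role here). For $u=u_1\cdots u_n$ put $\vartheta(u)=\{v_1\cdots v_n: v_i\in\vartheta(u_i)\}$, and similarly for infinite sequences; $\vartheta(X)=\bigcup_{x\in X}\vartheta(x)$; $\vartheta^0(u)=\{u\}$ and $\vartheta^{n+1}(u)=\bigcup_{v\in\vartheta^n(u)}\vartheta(v)$. It is compatible if $\psi(u)=\psi(v)$ for all $a\in\mathcal A$ and $u,v\in\vartheta(a)$; then the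 substitution matrix is $M_{i,j}=|v|_i$ for any $v\in\vartheta(j)$. It is primitive if $M$ is primitive with Perron–Frobenius eigenvalue $\lambda>1$. A compatible primitive $\vartheta$ is irreducible Pisot if $\lambda$ is a Pisot number and the characteristic polynomial of $M$ is irreducible over $\mathbb Z$. A word is legal if it is a subword of some element of $\vartheta^k(a)$, $a\in\mathcal A$, $k\in\mathbb N$. $X_\vartheta$ is the set of $x\in\mathcal A^{\mathbb N}$ all of whose finite subwords are legal, and $X_\vartheta^\infty=\bigcap_{n\ge0}\vartheta^n(X_\vartheta)$. Let $\mathbf L,\mathbf R$ be left and right Perron–Frobenius eigenvectors of $M$; $\mathbb H\subset\mathbb R^d$ is the hyperplane orthogonal to $\mathbf L$; $\pi$ is the linear projection along $\mathbf R$ onto $\mathbb H$; $h\colon\mathbb H\to\mathbb H$ is the restriction of $M$ to $\mathbb H$. For $w\in X_\vartheta$ let $\mathcal S_a(w)=\{\psi(w_{[1,n]}):n\ge0,\ w_{n+1}=a\}$ and $\mathcal R_a(w)=\overline{\pi(\mathcal S_a(w))}$. The subtile $\mathcal R_{\vartheta,a}$ is $\mathcal R_a(w)$ for any $w\in X_\vartheta^\infty$ with dense shift-orbit in $X_\vartheta$ (such $w$ exist, and the sets do not depend on the choice of $w$). $\mathcal P_\vartheta=\{(p,a,s)\in\mathcal A^*\times\mathcal A\times\mathcal A^*:\ pas\in\vartheta(b)\text{ for some }b\in\mathcal A\}$. *)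

theory Defs
  imports "HOL-Analysis.Analysis" "HOL-Computational_Algebra.Computational_Algebra"
    "HOL-Library.Sublist"
begin

text \<open>
  The alphabet is an arbitrary finite type; finite words are lists and one-sided infinite
  sequences are functions on \<^typ>\<open>nat\<close>. Sequences are indexed from \<open>0\<close>, so the letter
  written \<open>w\<^sub>n\<^sub>+\<^sub>1\<close> in the usual one-based notation is \<open>w n\<close>, and the prefix of length
  \<open>n\<close> is \<open>map w [0..<n]\<close>.
\<close>

subsection \<open>Random substitutions\<close>

definition random_substitution :: "('n \<Rightarrow> 'n list set) \<Rightarrow> bool" where
  "random_substitution \<theta> \<longleftrightarrow> (\<forall>a. finite (\<theta> a) \<and> \<theta> a \<noteq> {} \<and> [] \<notin> \<theta> a)"

definition subst_word :: "('n \<Rightarrow> 'n list set) \<Rightarrow> 'n list \<Rightarrow> 'n list set" where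
  "subst_word \<theta> u = {concat vs |vs. list_all2 (\<lambda>v a. v \<in> \<theta> a) vs u}"

fun subst_word_pow :: "('n \<Rightarrow> 'n list set) \<Rightarrow> nat \<Rightarrow> 'n list \<Rightarrow> 'n list set" where
  "subst_word_pow \<theta> 0 u = {u}"
| "subst_word_pow \<theta> (Suc n) u = (\<Union>v \<in> subst_word_pow \<theta> n u. subst_word \<theta> v)"

text \<open>
  A sequence \<open>y\<close> is the infinite concatenation of \<open>v 0, v 1, \<dots>\<close> if every finite concatenation
  \<open>v 0 \<dots> v (n - 1)\<close> is a prefix of \<open>y\<close>. This determines \<open>y\<close>, as no \<open>v i\<close> is empty.
\<close>

definition subst_seq :: "('n \<Rightarrow> 'n list set) \<Rightarrow> (nat \<Rightarrow> 'n) \<Rightarrow> (nat \<Rightarrow> 'n) set" where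
  "subst_seq \<theta> x = {y. \<exists>v. (\<forall>i. v i \<in> \<theta> (x i)) \<and>
     (\<forall>n. let c = concat (map v [0..<n]) in map y [0..<length c] = c)}"

definition subst_seqs :: "('n \<Rightarrow> 'n list set) \<Rightarrow> (nat \<Rightarrow> 'n) set \<Rightarrow> (nat \<Rightarrow> 'n) set" where
  "subst_seqs \<theta> X = (\<Union>x\<in>X. subst_seq \<theta> x)"

definition abel :: "'n::finite list \<Rightarrow> real ^ 'n" where
  "abel u = (\<chi> i. real (count_list u i))"

definition compatible :: "('n::finite \<Rightarrow> 'n list set) \<Rightarrow> bool" where
  "compatible \<theta> \<longleftrightarrow> (\<forall>a. \<forall>u\<in>\<theta> a. \<forall>v\<in>\<theta> a. abel u = abel v)"

text \<open>
  The entries are natural numbers; the coefficient ring is left open so that the same matrix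
  can be used over the integers (characteristic polynomial) and over the reals. The choice of
  the realisation is immaterial for compatible \<open>\<theta>\<close>.
\<close>

definition subst_matrix :: "('n::finite \<Rightarrow> 'n list set) \<Rightarrow> 'a::semiring_1 ^ 'n ^ 'n" where
  "subst_matrix \<theta> = (\<chi> i j. of_nat (count_list (SOME v. v \<in> \<theta> j) i))"


subsection \<open>Perron--Frobenius data and the irreducible Pisot property\<close>

definition mat_pow :: "'a::semiring_1 ^ 'n ^ 'n::finite \<Rightarrow> nat \<Rightarrow> 'a ^ 'n ^ 'n" where
  "mat_pow A k = (((**) A) ^^ k) (mat 1)"

definition primitive_matrix :: "real ^ 'n ^ 'n::finite \<Rightarrow> bool" where
  "primitive_matrix A \<longleftrightarrow>
     (\<forall>i j. 0 \<le> A $ i $ j) \<and> (\<exists>k>0. \<forall>i j. 0 < mat_pow A k $ i $ j)"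

definition is_eigenvalue :: "'a::field ^ 'n ^ 'n::finite \<Rightarrow> 'a \<Rightarrow> bool" where
  "is_eigenvalue A k \<longleftrightarrow> (\<exists>v. v \<noteq> 0 \<and> A *v v = k *s v)"

text \<open>
  The Perron--Frobenius eigenvalue of a primitive matrix is its positive eigenvalue that
  strictly dominates every other complex eigenvalue in modulus.
\<close>

definition pf_eigenvalue :: "real ^ 'n ^ 'n::finite \<Rightarrow> real \<Rightarrow> bool" where
  "pf_eigenvalue A l \<longleftrightarrow> 0 < l \<and> is_eigenvalue A l \<and>
     (\<forall>\<mu>. is_eigenvalue (\<chi> i j. complex_of_real (A $ i $ j)) \<mu> \<and> \<mu> \<noteq> of_real l
        \<longrightarrow> cmod \<mu> < l)"

definition right_pf_eigenvector :: "real ^ 'n ^ 'n::finite \<Rightarrow> real ^ 'n \<Rightarrow> bool" where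
  "right_pf_eigenvector A R \<longleftrightarrow>
     (\<forall>i. 0 < R $ i) \<and> (\<exists>l. pf_eigenvalue A l \<and> A *v R = l *\<^sub>R R)"

definition left_pf_eigenvector :: "real ^ 'n ^ 'n::finite \<Rightarrow> real ^ 'n \<Rightarrow> bool" where
  "left_pf_eigenvector A L \<longleftrightarrow>
     (\<forall>i. 0 < L $ i) \<and> (\<exists>l. pf_eigenvalue A l \<and> L v* A = l *\<^sub>R L)"

definition primitive_subst :: "('n::finite \<Rightarrow> 'n list set) \<Rightarrow> bool" where
  "primitive_subst \<theta> \<longleftrightarrow> primitive_matrix (subst_matrix \<theta>) \<and>
     (\<exists>l>1. pf_eigenvalue (subst_matrix \<theta>) l)"

definition charpoly :: "'a::comm_ring_1 ^ 'n ^ 'n::finite \<Rightarrow> 'a poly" where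
  "charpoly A = det (mat [:0, 1:] - (\<chi> i j. [:A $ i $ j:]))"

text \<open>
  A Pisot number is a real algebraic integer greater than 1 all of whose other conjugates lie
  in the open unit disc; \<open>p\<close> below is the minimal polynomial.
\<close>

definition pisot_number :: "real \<Rightarrow> bool" where
  "pisot_number l \<longleftrightarrow> 1 < l \<and>
     (\<exists>p :: int poly. lead_coeff p = 1 \<and> irreducible p \<and> poly (map_poly of_int p) l = 0 \<and>
        (\<forall>z :: complex. poly (map_poly of_int p) z = 0 \<and> z \<noteq> of_real l \<longrightarrow> cmod z < 1))"

definition irreducible_pisot :: "('n::finite \<Rightarrow> 'n list set) \<Rightarrow> bool" where
  "irreducible_pisot \<theta> \<longleftrightarrow> compatible \<theta> \<and> primitive_subst \<theta> \<and>
     (\<exists>l. pf_eigenvalue (subst_matrix \<theta>) l \<and> pisot_number l) \<and>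
     irreducible (charpoly (subst_matrix \<theta> :: int ^ 'n ^ 'n))"


subsection \<open>Subshifts\<close>

definition legal :: "('n \<Rightarrow> 'n list set) \<Rightarrow> 'n list \<Rightarrow> bool" where
  "legal \<theta> u \<longleftrightarrow> (\<exists>k a. \<exists>v \<in> subst_word_pow \<theta> k [a]. sublist u v)"

definition subshift :: "('n \<Rightarrow> 'n list set) \<Rightarrow> (nat \<Rightarrow> 'n) set" where
  "subshift \<theta> = {x. \<forall>m n. legal \<theta> (map x [m..<n])}"

definition subshift_inf :: "('n \<Rightarrow> 'n list set) \<Rightarrow> (nat \<Rightarrow> 'n) set" where
  "subshift_inf \<theta> = (\<Inter>n. (subst_seqs \<theta> ^^ n) (subshift \<theta>))"

definition shift_orbit :: "(nat \<Rightarrow> 'n) \<Rightarrow> (nat \<Rightarrow> 'n) set" where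
  "shift_orbit x = {(\<lambda>i. x (n + i)) |n. True}"

definition seq_topology :: "(nat \<Rightarrow> 'n) topology" where
  "seq_topology = product_topology (\<lambda>_. discrete_topology UNIV) UNIV"

definition generic_seqs :: "('n \<Rightarrow> 'n list set) \<Rightarrow> (nat \<Rightarrow> 'n) set" where
  "generic_seqs \<theta> =
     {w \<in> subshift_inf \<theta>. subshift \<theta> \<subseteq> seq_topology closure_of (shift_orbit w)}"


subsection \<open>Rauzy subtiles\<close>

definition hyperplane :: "real ^ 'n::finite \<Rightarrow> (real ^ 'n) set" where
  "hyperplane L = {x. L \<bullet> x = 0}"

definition proj :: "real ^ 'n::finite \<Rightarrow> real ^ 'n \<Rightarrow> real ^ 'n \<Rightarrow> real ^ 'n" where
  "proj L R x = x - ((L \<bullet> x) / (L \<bullet> R)) *\<^sub>R R"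

lemma proj_characterisation:
  assumes "L \<bullet> R \<noteq> 0"
  shows "y = proj L R x \<longleftrightarrow> y \<in> hyperplane L \<and> x - y \<in> span {R}"
proof
  assume "y = proj L R x"
  with assms show "y \<in> hyperplane L \<and> x - y \<in> span {R}"
    by (simp add: proj_def hyperplane_def inner_diff_right span_mul span_base)
next
  assume y: "y \<in> hyperplane L \<and> x - y \<in> span {R}"
  then obtain c where c: "x - y = c *\<^sub>R R"
    by (auto simp: span_singleton)
  have "L \<bullet> x = L \<bullet> (x - y)"
    using y by (simp add: hyperplane_def inner_diff_right)
  then have "L \<bullet> x = c * (L \<bullet> R)"
    by (simp add: c)
  then have "proj L R x = x - c *\<^sub>R R"
    using assms by (simp add: proj_def)
  then show "y = proj L R x"
    by (simp add: c [symmetric])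
qed

definition prefix_points :: "(nat \<Rightarrow> 'n::finite) \<Rightarrow> 'n \<Rightarrow> (real ^ 'n) set" where
  "prefix_points w a = {abel (map w [0..<n]) |n. w n = a}"

definition seq_subtile ::
    "real ^ 'n::finite \<Rightarrow> real ^ 'n \<Rightarrow> (nat \<Rightarrow> 'n) \<Rightarrow> 'n \<Rightarrow> (real ^ 'n) set" where
  "seq_subtile L R w a = closure (proj L R ` prefix_points w a)"

text \<open>
  The common value of \<^term>\<open>seq_subtile L R w a\<close> over all generic \<open>w\<close>; such \<open>w\<close> exist and the
  value does not depend on \<open>w\<close> in the irreducible Pisot case.
\<close>

definition subtile ::
    "('n::finite \<Rightarrow> 'n list set) \<Rightarrow> real ^ 'n \<Rightarrow> real ^ 'n \<Rightarrow> 'n \<Rightarrow> (real ^ 'n) set" where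
  "subtile \<theta> L R a = (THE T. \<exists>w \<in> generic_seqs \<theta>. T = seq_subtile L R w a)"

definition decompositions :: "('n \<Rightarrow> 'n list set) \<Rightarrow> ('n list \<times> 'n \<times> 'n list) set" where
  "decompositions \<theta> = {(p, a, s). \<exists>b. p @ [a] @ s \<in> \<theta> b}"

text \<open>
  The map \<open>h\<close> on the hyperplane is the restriction of multiplication by the substitution matrix.
  It is only ever applied to subsets of the hyperplane, so no restriction is spelled out.
\<close>

definition hyp_map :: "('n::finite \<Rightarrow> 'n list set) \<Rightarrow> real ^ 'n \<Rightarrow> real ^ 'n" where
  "hyp_map \<theta> x = subst_matrix \<theta> *v x"

definition self_consistent ::
    "('n::finite \<Rightarrow> 'n list set) \<Rightarrow> real ^ 'n \<Rightarrow> real ^ 'n \<Rightarrow> ('n \<Rightarrow> (real ^ 'n) set) \<Rightarrow> bool" where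
  "self_consistent \<theta> L R T \<longleftrightarrow>
     (\<forall>a. T a = (\<Union>b. \<Union>(p, c, s) \<in> {(p, c, s) \<in> decompositions \<theta>. c = a \<and> p @ [a] @ s \<in> \<theta> b}.
        (\<lambda>x. x + proj L R (abel p)) ` (hyp_map \<theta> ` T b)))"

definition compact_family :: "real ^ 'n::finite \<Rightarrow> ('n \<Rightarrow> (real ^ 'n) set) \<Rightarrow> bool" where
  "compact_family L T \<longleftrightarrow> (\<forall>a. T a \<noteq> {} \<and> compact (T a) \<and> T a \<subseteq> hyperplane L)"

end

theory Submission
  imports Defs
begin

text \<open>
  The right-hand side of the self-consistency relation is an operator on families of subsets
  of the hyperplane, called \<open>subdivide\<close> below. Its \<open>n\<close>-th iterate sends a family \<open>B\<close> to the points
  \<open>M\<^sup>n y + \<pi>(\<psi>(p))\<close> with \<open>p a s \<in> \<theta>\<^sup>n(b)\<close> and \<open>y \<in> B b\<close> (\<open>subdivide_iter_iff\<close>). Two facts drive the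
  proof.

  \<^item> \<open>M\<^sup>n\<close> tends to \<open>0\<close> on the hyperplane (\<open>contraction_tendsto_0\<close>). By the Pisot condition and the
    irreducibility of the characteristic polynomial, every complex eigenvalue of \<open>M\<close> other than
    the Perron--Frobenius eigenvalue lies in the open unit disc, and the latter has no eigenvector
    in the hyperplane. So after \<open>n\<close> subdivisions the starting point \<open>y\<close> hardly matters. This
    gives uniqueness at once, and it bounds \<open>\<pi>(\<psi>(u))\<close> uniformly over all legal words \<open>u\<close>.

  \<^item> A prefix of a realisation of \<open>\<theta>\<^sup>n(x)\<close> consists of a realisation of \<open>\<theta>\<^sup>n\<close> of a prefix of \<open>x\<close> followed
    by some \<open>p\<close> as above. So for \<open>w\<close> in \<open>X\<^sub>\<theta>\<^sup>\<infinity>\<close> the tiles of \<open>w\<close> are contained in every iterate of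
    \<open>subdivide\<close> on one fixed bounded family (\<open>seq_subtile_le_iterate\<close>).

  A sequence \<open>w\<close> is now constructed in which every realisation \<open>v\<close> of \<open>\<theta>\<^sup>N(b)\<close> is preceded by a prefix
  that itself lies in \<open>\<theta>\<^sup>N(q)\<close> for a legal word \<open>q\<close> (\<open>seed_exists\<close>). Such a prefix has a short
  projection, at most a constant times the norm of \<open>M\<^sup>N\<close> on the hyperplane. Hence the tiles of \<open>w\<close>
  contain everything that is contained in all iterates of \<open>subdivide\<close> on bounded families
  (\<open>seed_dominates\<close>): the tiles of every element of \<open>X\<^sub>\<theta>\<^sup>\<infinity>\<close>, and also the subdivision of the tiles of
  \<open>w\<close>. It follows that the tiles \<open>T\<close> of \<open>w\<close> are a fixed point.

  The independence of the generic sequence rests on a translation argument. If \<open>y\<close> is generic, then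
  every prefix of \<open>w\<close> occurs in \<open>y\<close>, and a limit of the projected positions of these occurrences is a
  vector \<open>t\<close> for which \<open>T + t\<close> is contained in the tiles of \<open>y\<close>, which are contained in \<open>T\<close>. As \<open>T\<close>
  is bounded and non-empty, \<open>t = 0\<close>, and so the tiles of \<open>y\<close> are equal to \<open>T\<close>.
\<close>

(* The symbol is used for vector components only; coefficients of formal power series
   would make it ambiguous. *)
no_notation fps_nth (infixl "$" 75)


section \<open>Irreducible integer polynomials and characteristic polynomials\<close>

definition ipoly :: "int poly \<Rightarrow> 'a::comm_ring_1 \<Rightarrow> 'a" where
  "ipoly p x = poly (map_poly of_int p) x"

lemma ipoly_0 [simp]: "ipoly 0 x = 0"
  and ipoly_pCons [simp]: "ipoly (pCons c p) x = of_int c + x * ipoly p x"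
  by (simp_all add: ipoly_def map_poly_pCons)

lemma ipoly_add [simp]: "ipoly (p + q) x = ipoly p x + ipoly q x"
  by (induction p q rule: poly_induct2) (simp_all add: algebra_simps)

lemma ipoly_uminus [simp]: "ipoly (- p) x = - ipoly p x"
  by (induction p) (simp_all add: algebra_simps)

lemma ipoly_diff [simp]: "ipoly (p - q) x = ipoly p x - ipoly q x"
  using ipoly_add[of p "- q"] by simp

lemma ipoly_smult [simp]: "ipoly (smult c p) x = of_int c * ipoly p x"
  by (induction p) (simp_all add: algebra_simps)

lemma ipoly_mult [simp]: "ipoly (p * q) x = ipoly p x * ipoly q x"
  by (induction p) (simp_all add: algebra_simps)

lemma ipoly_1 [simp]: "ipoly 1 x = 1"
  by (simp add: one_pCons)

lemma ipoly_of_int [simp]: "ipoly (of_int k) x = of_int k"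
  by (simp add: of_int_poly)

lemma ipoly_sum [simp]: "ipoly (sum f A) x = (\<Sum>i\<in>A. ipoly (f i) x)"
  by (induction A rule: infinite_finite_induct) simp_all

lemma ipoly_prod [simp]: "ipoly (prod f A) x = (\<Prod>i\<in>A. ipoly (f i) x)"
  by (induction A rule: infinite_finite_induct) simp_all

text \<open>
  Choose \<open>m\<close> of least degree among the non-zero integer polynomials vanishing at \<open>l\<close>. By pseudo-division
  \<open>m\<close> divides an integer multiple of every polynomial vanishing at \<open>l\<close>. The irreducible \<open>p\<close> is prime in
  \<open>\<int>[x]\<close>, so first \<open>p\<close> divides \<open>m\<close>, and then \<open>p\<close> divides \<open>f\<close>. In both steps the alternative is that \<open>p\<close>,
  or \<open>m\<close>, divides a non-zero constant, which is absurd as both vanish at \<open>l\<close>.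
\<close>
lemma irreducible_int_poly_dvd:
  fixes p f :: "int poly" and l :: "'a::field_char_0"
  assumes p: "irreducible p" and pl: "ipoly p l = 0" and fl: "ipoly f l = 0"
  shows "p dvd f"
proof (cases "f = 0")
  case False
  have p0: "p \<noteq> 0" using p by auto
  have pr: "prime_elem p" by (rule irreducible_imp_prime_poly[OF p])
  have const: False if "smult c 1 = p * q" "c \<noteq> 0" for c q
  proof -
    have "ipoly (smult c 1) l = ipoly (p * q) l" by (simp only: that)
    then show False using that(2) pl by simp
  qed
  (* any non-zero polynomial of least degree with root l serves as a minimal polynomial *)
  define P where "P m \<longleftrightarrow> m \<noteq> 0 \<and> ipoly m l = 0" for m
  obtain m where m: "P m" and min: "\<And>k. P k \<Longrightarrow> degree m \<le> degree k"
    using ex_has_least_nat[of P p degree] p0 pl by (auto simp: P_def)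
  have div: "\<exists>a q. a \<noteq> 0 \<and> smult a g = m * q" if "ipoly g l = 0" for g
  proof -
    obtain a q where a: "a \<noteq> 0" "smult a g = m * q + pseudo_mod g m"
      and r: "pseudo_mod g m = 0 \<or> degree (pseudo_mod g m) < degree m"
      using pseudo_mod[of m g] m by (auto simp: P_def)
    have "ipoly (smult a g) l = ipoly (m * q + pseudo_mod g m) l" by (simp only: a)
    then have "ipoly (pseudo_mod g m) l = 0" using that m by (simp add: P_def)
    then have "pseudo_mod g m = 0" using r min[of "pseudo_mod g m"] by (force simp: P_def)
    then show ?thesis using a by auto
  qed
  have pm: "p dvd m"
  proof -
    obtain c q where c: "c \<noteq> 0" "smult c p = m * q" using div[OF pl] by blast
    have "p dvd m * q" using c(2)[symmetric] by (simp add: dvd_smult)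
    then have "p dvd m \<or> p dvd q" using pr by (simp add: prime_elem_dvd_mult_iff)
    moreover have False if pq: "p dvd q"
    proof -
      obtain q' where "q = p * q'" using pq by (elim dvdE)
      then have "p * smult c 1 = p * (m * q')" using c(2) by (simp add: mult.left_commute)
      then have e: "smult c 1 = m * q'" using p0 by (metis mult_cancel_left)
      have "ipoly (smult c 1) l = ipoly (m * q') l" by (simp only: e)
      then show False using c(1) m by (simp add: P_def)
    qed
    ultimately show ?thesis by blast
  qed
  obtain c q where c: "c \<noteq> 0" "smult c f = m * q" using div[OF fl] by blast
  have "p dvd smult c 1 * f" using pm c(2) by simp
  then have "p dvd smult c 1 \<or> p dvd f" using prime_elem_dvd_mult_iff[OF pr] by blast
  then show ?thesis using const c(1) by blast
qed auto

text \<open>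
  The coefficients are integers and the eigenvalue lies in an arbitrary field, so that the lemma
  applies both to the real Perron--Frobenius eigenvalue and to the complex eigenvalues.
\<close>
lemma eigenvalue_imp_charpoly_root:
  fixes A :: "int ^ 'n ^ 'n::finite" and v :: "'a::field ^ 'n"
  assumes v: "v \<noteq> 0" "(\<chi> i j. of_int (A $ i $ j)) *v v = x *s v"
  shows "ipoly (charpoly A) x = 0"
proof -
  let ?B = "(\<chi> i j. of_int (A $ i $ j)) :: 'a ^ 'n ^ 'n"
  have entry: "ipoly ((mat [:0, 1:] - (\<chi> i j. [:A $ i $ j:])) $ i $ j) x = (mat x - ?B) $ i $ j" for i j
    by (simp add: mat_def)
  have "ipoly (charpoly A) x = det (mat x - ?B)"
    unfolding charpoly_def det_def by (simp only: ipoly_sum ipoly_mult ipoly_prod ipoly_of_int entry)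
  moreover have "(mat x - ?B) *v v = 0"
    using v(2) by (simp add: matrix_vector_mult_diff_rdistrib vec_eq_iff matrix_vector_mult_def mat_def
        sum.delta if_distrib[of "\<lambda>z. z * _"] sum_subtractf left_diff_distrib cong: if_cong)
  then have "det (mat x - ?B) = 0"
    using v(1) by (metis invertible_det_nz matrix_left_invertible_ker invertible_def)
  ultimately show ?thesis by simp
qed

section \<open>Convergence of matrix powers from bounds on eigenvalues\<close>

lemma mat_vec_mult_sum: "A *v (\<Sum>i\<in>I. f i) = (\<Sum>i\<in>I. A *v f i)"
  for A :: "'a::field ^ 'n ^ 'n::finite"
  by (induction I rule: infinite_finite_induct) (simp_all add: matrix_vector_right_distrib)

definition vpoly :: "'a::field ^ 'n ^ 'n::finite \<Rightarrow> 'a poly \<Rightarrow> 'a ^ 'n \<Rightarrow> 'a ^ 'n" where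
  "vpoly A q v = (\<Sum>i\<le>degree q. coeff q i *s ((*v) A ^^ i) v)"

lemma vpoly_atMost:
  assumes "degree q \<le> n"
  shows "vpoly A q v = (\<Sum>i\<le>n. coeff q i *s ((*v) A ^^ i) v)"
  unfolding vpoly_def
  by (rule sum.mono_neutral_left) (use assms in \<open>auto simp: coeff_eq_0\<close>)

lemma matrix_iterate_diff_scale:
  fixes A :: "'a::field ^ 'n ^ 'n::finite"
  shows "((*v) A ^^ i) (x - c *s y) = ((*v) A ^^ i) x - c *s ((*v) A ^^ i) y"
  by (induction i) (simp_all add: matrix_vector_mult_diff_distrib vector_scalar_commute)

text \<open>
  The factor \<open>A - c\<close> may be split off on the outside or on the inside of \<open>q(A)\<close>. The outer form
  exhibits eigenvectors, the inner one allows induction on the degree.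
\<close>
lemma vpoly_linear_factor:
  fixes A :: "'a::field ^ 'n ^ 'n::finite"
  shows "vpoly A ([:- c, 1:] * q) v = A *v vpoly A q v - c *s vpoly A q v"
    and "vpoly A ([:- c, 1:] * q) v = vpoly A q (A *v v - c *s v)"
proof -
  let ?n = "degree q"
  have "degree ([:- c, 1:] * q) \<le> Suc ?n"
    using degree_mult_le[of "[:- c, 1:]" q] by simp
  then have "vpoly A ([:- c, 1:] * q) v = (\<Sum>i\<le>Suc ?n. coeff ([:- c, 1:] * q) i *s ((*v) A ^^ i) v)"
    by (rule vpoly_atMost)
  also have "\<dots> = (\<Sum>i\<le>Suc ?n. coeff (pCons 0 q) i *s ((*v) A ^^ i) v - c *s (coeff q i *s ((*v) A ^^ i) v))"
  proof (rule sum.cong[OF refl])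
    fix i
    have "coeff ([:- c, 1:] * q) i = coeff (pCons 0 q) i - c * coeff q i"
      by (simp add: mult_pCons_left)
    then show "coeff ([:- c, 1:] * q) i *s ((*v) A ^^ i) v
        = coeff (pCons 0 q) i *s ((*v) A ^^ i) v - c *s (coeff q i *s ((*v) A ^^ i) v)"
      by (simp only: vec.scale_left_diff_distrib vec.scale_scale)
  qed
  also have "\<dots> = (\<Sum>i\<le>Suc ?n. coeff (pCons 0 q) i *s ((*v) A ^^ i) v)
      - c *s (\<Sum>i\<le>Suc ?n. coeff q i *s ((*v) A ^^ i) v)"
    by (simp only: vec.scale_sum_right sum_subtractf)
  also have "(\<Sum>i\<le>Suc ?n. coeff q i *s ((*v) A ^^ i) v) = vpoly A q v"
    by (rule vpoly_atMost[symmetric]) simp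
  also have "(\<Sum>i\<le>Suc ?n. coeff (pCons 0 q) i *s ((*v) A ^^ i) v)
      = (\<Sum>i\<le>?n. coeff q i *s (A *v (((*v) A ^^ i) v)))"
    by (subst sum.atMost_Suc_shift) simp
  finally have *: "vpoly A ([:- c, 1:] * q) v =
      (\<Sum>i\<le>?n. coeff q i *s (A *v (((*v) A ^^ i) v))) - c *s vpoly A q v" .
  then show "vpoly A ([:- c, 1:] * q) v = A *v vpoly A q v - c *s vpoly A q v"
    by (simp add: vpoly_def mat_vec_mult_sum vector_scalar_commute)
  have "coeff q i *s ((*v) A ^^ i) (A *v v - c *s v)
      = coeff q i *s (A *v ((*v) A ^^ i) v) - c *s (coeff q i *s ((*v) A ^^ i) v)" for i
    by (simp add: matrix_iterate_diff_scale vec.scale_right_diff_distrib funpow_swap1 mult.commute)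
  then show "vpoly A ([:- c, 1:] * q) v = vpoly A q (A *v v - c *s v)"
    unfolding * by (simp only: vpoly_def vec.scale_sum_right sum_subtractf)
qed

lemma norm_vector_smult_complex: "norm (c *s (v :: complex ^ 'n::finite)) = cmod c * norm v"
  by (simp add: norm_vec_def norm_mult L2_set_right_distrib)

text \<open>
  Summing the recurrence gives \<open>s \<le> |x 0| + |c| s + \<Sum>|y n|\<close> for every partial sum \<open>s\<close> of the
  norms of \<open>x\<close>.
\<close>
lemma summable_linear_recurrence:
  fixes x y :: "nat \<Rightarrow> complex ^ 'n::finite"
  assumes rec: "\<And>n. x (Suc n) = c *s x n + y n" and c: "cmod c < 1"
    and y: "summable (\<lambda>n. norm (y n))"
  shows "summable (\<lambda>n. norm (x n))"
proof (rule summableI_nonneg_bounded[where x = "(norm (x 0) + (\<Sum>n. norm (y n))) / (1 - cmod c)"])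
  fix N
  have "(\<Sum>n<N. norm (x n)) \<le> (\<Sum>n<Suc N. norm (x n))" by simp
  also have "\<dots> = norm (x 0) + (\<Sum>n<N. norm (x (Suc n)))"
    by (rule sum.lessThan_Suc_shift)
  also have "(\<Sum>n<N. norm (x (Suc n))) \<le> (\<Sum>n<N. cmod c * norm (x n) + norm (y n))"
    by (rule sum_mono) (metis rec norm_triangle_ineq norm_vector_smult_complex)
  also have "\<dots> = cmod c * (\<Sum>n<N. norm (x n)) + (\<Sum>n<N. norm (y n))"
    by (simp add: sum.distrib sum_distrib_left)
  also have "(\<Sum>n<N. norm (y n)) \<le> (\<Sum>n. norm (y n))"
    by (rule sum_le_suminf[OF y]) auto
  finally have "(1 - cmod c) * (\<Sum>n<N. norm (x n)) \<le> norm (x 0) + (\<Sum>n. norm (y n))"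
    by (simp add: algebra_simps)
  then show "(\<Sum>n<N. norm (x n)) \<le> (norm (x 0) + (\<Sum>n. norm (y n))) / (1 - cmod c)"
    using c by (simp add: pos_le_divide_eq mult.commute)
qed simp

text \<open>
  This takes the place of the Jordan normal form. Induction on the degree of an annihilating
  polynomial \<open>q = (x - c) q'\<close>: if \<open>|c| < 1\<close>, then \<open>(A - c) v\<close> is annihilated by \<open>q'\<close>, and the iterates of
  \<open>v\<close> satisfy a linear recurrence with ratio \<open>c\<close> and summable inhomogeneity. Otherwise \<open>q'(A) v\<close>
  would be an eigenvector in \<open>W\<close> for the eigenvalue \<open>c\<close>, hence it is \<open>0\<close> and \<open>q'\<close> annihilates \<open>v\<close>.
\<close>
lemma summable_iterates_annihilated:
  fixes A :: "complex ^ 'n ^ 'n::finite"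
  assumes W: "vec.subspace W" and inv: "\<And>v. v \<in> W \<Longrightarrow> A *v v \<in> W"
    and eig: "\<And>v c. v \<in> W \<Longrightarrow> v \<noteq> 0 \<Longrightarrow> A *v v = c *s v \<Longrightarrow> cmod c < 1"
  shows "q \<noteq> 0 \<Longrightarrow> v \<in> W \<Longrightarrow> vpoly A q v = 0 \<Longrightarrow> summable (\<lambda>n. norm (((*v) A ^^ n) v))"
proof (induction "degree q" arbitrary: q v)
  case 0
  then obtain k where k: "q = [:k:]" "k \<noteq> 0" by (metis degree_eq_zeroE pCons_0_0)
  then have "v = 0" using 0 by (simp add: vpoly_def)
  moreover have "((*v) A ^^ n) 0 = 0" for n by (induction n) auto
  ultimately show ?case by simp
next
  case (Suc d)
  then have "\<not> constant (poly q)" by (simp add: constant_degree)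
  then obtain c where "poly q c = 0" using fundamental_theorem_of_algebra by blast
  then obtain q' where q': "q = [:- c, 1:] * q'" by (auto simp: poly_eq_0_iff_dvd elim: dvdE)
  have q'0: "q' \<noteq> 0" using Suc.prems(1) q' by auto
  have deg: "d = degree q'" using Suc.hyps(2) q'0 unfolding q' by (subst (asm) degree_mult_eq) auto
  have iter: "((*v) A ^^ n) u \<in> W" if "u \<in> W" for n u
    by (induction n) (use that inv in auto)
  have polyW: "vpoly A q' v \<in> W" unfolding vpoly_def
    by (intro vec.subspace_sum[OF W] vec.subspace_scale[OF W] iter Suc.prems)
  show ?case
  proof (cases "cmod c < 1")
    case True
    let ?y = "A *v v - c *s v"
    have "?y \<in> W" using Suc.prems inv by (intro vec.subspace_diff[OF W] vec.subspace_scale[OF W]) auto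
    moreover have "vpoly A q' ?y = 0" using Suc.prems(3) q' vpoly_linear_factor(2) by metis
    ultimately have "summable (\<lambda>n. norm (((*v) A ^^ n) ?y))" using Suc.hyps(1)[OF deg q'0] by blast
    moreover have "((*v) A ^^ Suc n) v = c *s ((*v) A ^^ n) v + ((*v) A ^^ n) ?y" for n
      by (simp add: matrix_iterate_diff_scale funpow_swap1)
    ultimately show ?thesis 
      using True by (metis (no_types, lifting) summable_linear_recurrence[where c = c and y = "\<lambda>n. ((*v) A ^^ n) ?y" and x = "\<lambda>n. ((*v) A ^^ n) v"])
  next
    case False
    have "A *v vpoly A q' v = c *s vpoly A q' v"
      using Suc.prems(3) vpoly_linear_factor(1)[of A c q' v] q' by simp
    then have "vpoly A q' v = 0" using eig polyW False by blast
    then show ?thesis using Suc.hyps(1)[OF deg q'0] Suc.prems(2) by blast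
  qed
qed

text \<open>
  The space has finite real dimension \<open>N\<close>, so the vectors \<open>v, A v, \<dots>, A\<^sup>N v\<close> either repeat
  or are linearly dependent over the reals.
\<close>
lemma annihilating_poly_exists:
  fixes A :: "complex ^ 'n ^ 'n::finite"
  shows "\<exists>q. q \<noteq> 0 \<and> vpoly A q v = 0"
proof -
  define f where "f i = ((*v) A ^^ i) v" for i
  define N where "N = DIM(complex ^ 'n)"
  show ?thesis
  proof (cases "inj_on f {..N}")
    case True
    then have "card (f ` {..N}) > DIM(complex ^ 'n)" by (simp add: card_image N_def)
    then have "dependent (f ` {..N})" by (intro dependent_biggerset) auto
    then obtain u where u: "\<exists>x\<in>f ` {..N}. u x \<noteq> (0::real)" "(\<Sum>x\<in>f ` {..N}. u x *\<^sub>R x) = 0"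
      by (auto simp: dependent_finite)
    (* the coefficient of A^i v is the one that the dependency gives to this vector *)
    define q where "q = Poly (map (\<lambda>i. complex_of_real (u (f i))) [0..<Suc N])"
    have co: "coeff q i = complex_of_real (u (f i))" if "i \<le> N" for i
      using that by (simp add: q_def coeff_Poly_eq nth_default_def del: upt_Suc)
    have "degree q \<le> N" by (rule degree_le) (simp add: q_def coeff_Poly_eq nth_default_def)
    then have "vpoly A q v = (\<Sum>i\<le>N. complex_of_real (u (f i)) *s f i)"
      by (simp add: vpoly_atMost co f_def)
    also have "\<dots> = (\<Sum>i\<le>N. u (f i) *\<^sub>R f i)"
      by (simp add: vec_eq_iff) (simp add: scaleR_conv_of_real)
    also have "\<dots> = (\<Sum>x\<in>f ` {..N}. u x *\<^sub>R x)" using True by (simp add: sum.reindex)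
    finally have "vpoly A q v = 0" using u(2) by simp
    moreover have "q \<noteq> 0" using u(1) co by fastforce
    ultimately show ?thesis by blast
  next
    case False
    then obtain i j where ij: "i \<le> N" "j \<le> N" "i \<noteq> j" "f i = f j" by (auto simp: inj_on_def)
    let ?q = "monom 1 i - monom 1 j :: complex poly"
    have "degree ?q \<le> N" by (intro degree_diff_le) (use ij in \<open>auto simp: degree_monom_eq\<close>)
    then have "vpoly A ?q v = (\<Sum>k\<le>N. coeff ?q k *s f k)" by (simp add: vpoly_atMost f_def)
    also have "\<dots> = (\<Sum>k\<le>N. (if k = i then f k else 0) - (if k = j then f k else 0))"
      by (rule sum.cong) (auto simp: vec.scale_left_diff_distrib)
    also have "\<dots> = f i - f j" using ij by (simp add: sum_subtractf)
    finally have "vpoly A ?q v = 0" using ij by simp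
    moreover have "coeff ?q i = 1" using ij by simp
    then have "?q \<noteq> 0" by (metis coeff_0 zero_neq_one)
    ultimately show ?thesis by blast
  qed
qed

lemma summable_iterates:
  fixes A :: "complex ^ 'n ^ 'n::finite"
  assumes "vec.subspace W" and "\<And>v. v \<in> W \<Longrightarrow> A *v v \<in> W"
    and "\<And>v c. v \<in> W \<Longrightarrow> v \<noteq> 0 \<Longrightarrow> A *v v = c *s v \<Longrightarrow> cmod c < 1"
    and "v \<in> W"
  shows "summable (\<lambda>n. norm (((*v) A ^^ n) v))"
proof -
  obtain q where "q \<noteq> 0" "vpoly A q v = 0" using annihilating_poly_exists by blast
  then show ?thesis using assms summable_iterates_annihilated[of W A q v] by blast
qed

section \<open>Perron--Frobenius and Pisot eigenvalues\<close>

lemma mat_pow_mult_vec: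
  fixes A :: "'a::comm_semiring_1 ^ 'n ^ 'n::finite"
  shows "mat_pow A k *v x = ((*v) A ^^ k) x"
  by (induction k) (simp_all add: mat_pow_def matrix_vector_mul_assoc[symmetric])

abbreviation complexify :: "real ^ 'n ^ 'n::finite \<Rightarrow> complex ^ 'n ^ 'n" where
  "complexify A \<equiv> (\<chi> i j. complex_of_real (A $ i $ j))"

lemma complexify_mult_vec:
  "complexify A *v (\<chi> i. complex_of_real (x $ i)) = (\<chi> i. complex_of_real ((A *v x) $ i))"
  by (simp add: vec_eq_iff matrix_vector_mult_def)

lemma eigenvalue_complexify:
  assumes "is_eigenvalue A (l::real)"
  shows "is_eigenvalue (complexify A) (of_real l)"
proof -
  obtain v where v: "v \<noteq> 0" "A *v v = l *s v" using assms by (auto simp: is_eigenvalue_def)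
  have "(\<chi> i. complex_of_real (v $ i)) \<noteq> 0" using v by (auto simp: vec_eq_iff)
  moreover have "complexify A *v (\<chi> i. complex_of_real (v $ i)) = of_real l *s (\<chi> i. complex_of_real (v $ i))"
    by (simp add: complexify_mult_vec v(2) vec_eq_iff)
  ultimately show ?thesis unfolding is_eigenvalue_def by blast
qed

lemma pf_eigenvalue_unique:
  assumes "pf_eigenvalue A k" "pf_eigenvalue A l"
  shows "k = l"
proof (rule ccontr)
  assume "k \<noteq> l"
  then have "cmod (of_real k) < l" "cmod (of_real l) < k"
    using assms eigenvalue_complexify[of A k] eigenvalue_complexify[of A l]
    unfolding pf_eigenvalue_def by (metis of_real_eq_iff)+
  then show False by simp
qed

lemma inner_mult_vec_left_eigenvector:
  fixes A :: "real ^ 'n ^ 'n::finite"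
  assumes "L v* A = l *\<^sub>R L"
  shows "L \<bullet> (A *v x) = l * (L \<bullet> x)"
  using assms by (simp add: dot_lmul_matrix[symmetric])

text \<open>
  Let \<open>w\<close> consist of the absolute values of the entries of \<open>u\<close>. Then \<open>A w \<ge> l w\<close> entrywise, and pairing
  with \<open>L > 0\<close> forces equality. Hence \<open>w - u \<ge> 0\<close> is an eigenvector as well, and if it is not zero,
  then a positive power of \<open>A\<close> makes all its entries positive. Then all entries of \<open>u\<close> are negative,
  contradicting \<open>L \<bullet> u = 0\<close>.
\<close>
lemma pf_eigenvector_in_hyperplane_eq_0:
  fixes A :: "real ^ 'n ^ 'n::finite"
  assumes prim: "primitive_matrix A" and pos: "\<And>i. 0 < L $ i" and l: "0 < l"
    and left: "L v* A = l *\<^sub>R L" and u: "A *v u = l *\<^sub>R u" "L \<bullet> u = 0"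
  shows "u = 0"
proof (rule ccontr)
  assume u0: "u \<noteq> 0"
  obtain k where k: "\<And>i j. 0 < mat_pow A k $ i $ j" using prim by (auto simp: primitive_matrix_def)
  have A0: "0 \<le> A $ i $ j" for i j using prim by (simp add: primitive_matrix_def)
  define w where "w = (\<chi> i. \<bar>u $ i\<bar>)"
  define z where "z = w - u"
  have ge: "l * w $ i \<le> (A *v w) $ i" for i
  proof -
    have "l * w $ i = \<bar>(A *v u) $ i\<bar>" using l by (simp add: u w_def abs_mult)
    also have "\<dots> \<le> (\<Sum>j\<in>UNIV. \<bar>A $ i $ j * u $ j\<bar>)" unfolding matrix_vector_mult_def by simp
    also have "\<dots> = (A *v w) $ i" by (simp add: w_def matrix_vector_mult_def abs_mult A0)
    finally show ?thesis .
  qed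
  have "(\<Sum>i\<in>UNIV. L $ i * ((A *v w) $ i - l * w $ i)) = L \<bullet> (A *v w - l *\<^sub>R w)"
    by (simp add: inner_vec_def)
  also have "\<dots> = 0" by (simp add: inner_diff_right inner_mult_vec_left_eigenvector[OF left])
  finally have "L $ i * ((A *v w) $ i - l * w $ i) = 0" for i
    using sum_nonneg_eq_0_iff[of UNIV "\<lambda>i. L $ i * ((A *v w) $ i - l * w $ i)"] ge pos
    by (simp add: less_imp_le)
  then have "A *v w = l *\<^sub>R w" using pos by (simp add: vec_eq_iff) (metis less_irrefl)
  then have Az: "A *v z = l *\<^sub>R z" by (simp add: z_def matrix_vector_mult_diff_distrib u scaleR_diff_right)
  have pow: "((*v) A ^^ n) z = l ^ n *\<^sub>R z" for n
    by (induction n) (simp_all add: Az matrix_vector_mult_scaleR mult.commute)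
  have z0: "0 \<le> z $ i" for i by (simp add: z_def w_def)
  have "z \<noteq> 0"
  proof
    assume "z = 0"
    then have nn: "0 \<le> u $ i" for i by (simp add: z_def w_def vec_eq_iff) (metis abs_ge_zero)
    then have "L $ i * u $ i = 0" for i
      using u(2) pos sum_nonneg_eq_0_iff[of UNIV "\<lambda>i. L $ i * u $ i"]
      by (simp add: inner_vec_def less_imp_le)
    then show False using u0 pos by (simp add: vec_eq_iff) (metis less_irrefl)
  qed
  then obtain j where j: "0 < z $ j" using z0 by (auto simp: vec_eq_iff order.order_iff_strict)
  have neg: "u $ i < 0" for i
  proof -
    have "0 < mat_pow A k $ i $ j * z $ j" using k j by simp
    also have "\<dots> \<le> (mat_pow A k *v z) $ i" unfolding matrix_vector_mult_def
      by simp (rule member_le_sum, auto intro: mult_nonneg_nonneg z0 less_imp_le k)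
    finally have "0 < l ^ k * z $ i" by (simp add: mat_pow_mult_vec pow)
    then have "0 < z $ i" using l by (simp add: zero_less_mult_iff)
    then show ?thesis by (simp add: z_def w_def)
  qed
  have "0 < (\<Sum>i\<in>UNIV. - (L $ i * u $ i))"
    by (rule sum_pos) (auto simp: neg pos mult_pos_neg)
  then show False using u by (simp add: inner_vec_def sum_negf)
qed

text \<open>
  The hyperplane orthogonal to a left eigenvector is invariant, and so is its complexification, on
  which the bound for complex eigenvalues can be applied.
\<close>
lemma summable_iterates_hyperplane:
  fixes A :: "real ^ 'n ^ 'n::finite"
  assumes left: "L v* A = l *\<^sub>R L" and x: "L \<bullet> x = 0"
    and eig: "\<And>v c. v \<noteq> 0 \<Longrightarrow> complexify A *v v = c *s v \<Longrightarrow>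
      (\<Sum>i\<in>UNIV. of_real (L $ i) * v $ i) = 0 \<Longrightarrow> cmod c < 1"
  shows "summable (\<lambda>n. norm (((*v) A ^^ n) x))"
proof -
  define W where "W = {v. (\<Sum>i\<in>UNIV. complex_of_real (L $ i) * v $ i) = 0}"
  let ?x = "\<chi> i. complex_of_real (x $ i)"
  have sub: "vec.subspace W"
    by (auto simp: vec.subspace_def W_def algebra_simps sum.distrib sum_distrib_left[symmetric])
  have left': "(\<Sum>i\<in>UNIV. L $ i * A $ i $ j) = l * L $ j" for j
    using left by (simp add: vec_eq_iff vector_matrix_mult_def mult.commute)
  have inv: "complexify A *v v \<in> W" if "v \<in> W" for v
  proof -
    have "(\<Sum>i\<in>UNIV. of_real (L $ i) * (complexify A *v v) $ i)
        = (\<Sum>i\<in>UNIV. \<Sum>j\<in>UNIV. complex_of_real (L $ i * A $ i $ j) * v $ j)"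
      by (simp add: matrix_vector_mult_def sum_distrib_left mult.assoc)
    also have "\<dots> = (\<Sum>j\<in>UNIV. \<Sum>i\<in>UNIV. complex_of_real (L $ i * A $ i $ j) * v $ j)"
      by (rule sum.swap)
    also have "\<dots> = (\<Sum>j\<in>UNIV. complex_of_real (\<Sum>i\<in>UNIV. L $ i * A $ i $ j) * v $ j)"
      by (simp add: sum_distrib_right)
    also have "\<dots> = of_real l * (\<Sum>j\<in>UNIV. of_real (L $ j) * v $ j)"
      by (simp add: left' sum_distrib_left mult.assoc)
    finally show ?thesis using that by (simp add: W_def)
  qed
  have "?x \<in> W"
  proof -
    have "complex_of_real (L \<bullet> x) = 0" using x by simp
    then show ?thesis by (simp add: W_def inner_vec_def)
  qed
  then have "summable (\<lambda>n. norm (((*v) (complexify A) ^^ n) ?x))"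
    by (intro summable_iterates[OF sub]) (use inv eig in \<open>auto simp: W_def\<close>)
  moreover have "((*v) (complexify A) ^^ n) ?x = (\<chi> i. complex_of_real ((((*v) A ^^ n) x) $ i))" for n
    by (induction n) (simp_all add: complexify_mult_vec)
  moreover have "norm (\<chi> i. complex_of_real (y $ i)) = norm y" for y :: "real ^ 'n"
    by (simp add: norm_vec_def)
  ultimately show ?thesis by simp
qed

text \<open>
  The characteristic polynomial is irreducible and vanishes at \<open>l\<close>, so it divides the minimal
  polynomial of the Pisot number \<open>l\<close>; every eigenvalue is therefore a conjugate of \<open>l\<close>.
\<close>
lemma irreducible_pisot_eigenvalue_bound:
  fixes A :: "int ^ 'n ^ 'n::finite" and v :: "complex ^ 'n"
  assumes irr: "irreducible (charpoly A)" and pisot: "pisot_number l"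
    and l: "is_eigenvalue (\<chi> i j. real_of_int (A $ i $ j)) l"
    and v: "v \<noteq> 0" "(\<chi> i j. of_int (A $ i $ j)) *v v = c *s v" "c \<noteq> of_real l"
  shows "cmod c < 1"
proof -
  obtain p :: "int poly" where p: "ipoly p l = 0" "\<And>z. ipoly p z = 0 \<Longrightarrow> z \<noteq> of_real l \<Longrightarrow> cmod z < 1"
    using pisot by (auto simp: pisot_number_def ipoly_def)
  obtain u where u: "u \<noteq> 0" "(\<chi> i j. real_of_int (A $ i $ j)) *v u = l *s u"
    using l by (auto simp: is_eigenvalue_def)
  have "ipoly (charpoly A) l = 0" by (rule eigenvalue_imp_charpoly_root[OF u])
  then have "charpoly A dvd p" using irreducible_int_poly_dvd[OF irr _ p(1)] by blast
  moreover have "ipoly (charpoly A) c = 0" by (rule eigenvalue_imp_charpoly_root[OF v(1,2)])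
  ultimately have "ipoly p c = 0" by (auto elim: dvdE)
  then show ?thesis using p(2) v(3) by blast
qed

section \<open>Images of words under a random substitution\<close>

lemma subst_word_Nil [simp]: "subst_word \<theta> [] = {[]}"
  by (auto simp: subst_word_def)

lemma subst_word_Cons: "subst_word \<theta> (a # u) = {v @ w |v w. v \<in> \<theta> a \<and> w \<in> subst_word \<theta> u}"
proof (intro equalityI subsetI)
  fix x assume "x \<in> {v @ w |v w. v \<in> \<theta> a \<and> w \<in> subst_word \<theta> u}"
  then obtain v vs where "x = v @ concat vs" "v \<in> \<theta> a" "list_all2 (\<lambda>v a. v \<in> \<theta> a) vs u"
    by (auto simp: subst_word_def)
  then show "x \<in> subst_word \<theta> (a # u)"
    unfolding subst_word_def by (intro CollectI exI[of _ "v # vs"]) simp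
next
  fix x assume "x \<in> subst_word \<theta> (a # u)"
  then obtain z zs where "x = z @ concat zs" "z \<in> \<theta> a" "list_all2 (\<lambda>v a. v \<in> \<theta> a) zs u"
    by (auto simp: subst_word_def list_all2_Cons2)
  then show "x \<in> {v @ w |v w. v \<in> \<theta> a \<and> w \<in> subst_word \<theta> u}"
    unfolding subst_word_def by blast
qed

lemma subst_word_singleton [simp]: "subst_word \<theta> [a] = \<theta> a"
  by (simp add: subst_word_Cons)

lemma subst_word_append: "subst_word \<theta> (u @ v) = {x @ y |x y. x \<in> subst_word \<theta> u \<and> y \<in> subst_word \<theta> v}"
proof (induction u)
  case (Cons a u)
  show ?case unfolding append_Cons subst_word_Cons Cons by (auto, (metis append_assoc)+)
qed simp

lemma subst_word_appendI: "x \<in> subst_word \<theta> u \<Longrightarrow> y \<in> subst_word \<theta> v \<Longrightarrow> x @ y \<in> subst_word \<theta> (u @ v)"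
  by (auto simp: subst_word_append)

text \<open>
  The combinatorial core of the self-consistency relation: \<open>c\<close> is the letter whose realisation
  covers the marked occurrence of \<open>a\<close>.
\<close>
lemma subst_word_letter_ancestor:
  assumes "p @ [a] @ s \<in> subst_word \<theta> u"
  shows "\<exists>q c r q' p' s'. u = q @ [c] @ r \<and> q' \<in> subst_word \<theta> q \<and> p = q' @ p' \<and> p' @ [a] @ s' \<in> \<theta> c"
  using assms
proof (induction u arbitrary: p)
  case (Cons b u)
  then obtain v w where vw: "p @ [a] @ s = v @ w" "v \<in> \<theta> b" "w \<in> subst_word \<theta> u"
    by (auto simp: subst_word_Cons)
  show ?case
  proof (cases "length p < length v")
    case True
    then have "v = p @ [a] @ take (length v - length p - 1) s"
      using vw(1) by (auto simp: append_eq_append_conv2 Cons_eq_append_conv)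
    then have "p @ [a] @ take (length v - length p - 1) s \<in> \<theta> b" using vw(2) by metis
    then show ?thesis by - (rule exI[of _ "[]"], rule exI[of _ b], rule exI[of _ u], auto)
  next
    case False
    then obtain p'' where p'': "p = v @ p''" "w = p'' @ [a] @ s"
      using vw(1) by (auto simp: append_eq_append_conv2)
    then obtain q c r q' p' s' where "u = q @ [c] @ r" "q' \<in> subst_word \<theta> q" "p'' = q' @ p'" "p' @ [a] @ s' \<in> \<theta> c"
      using Cons.IH vw(3) by blast
    then show ?thesis using p'' vw(2)
      by (intro exI[of _ "b # q"] exI[of _ c] exI[of _ r] exI[of _ "v @ q'"] exI[of _ p'] exI[of _ s'])
        (auto simp: subst_word_Cons)
  qed
qed simp

lemma subst_word_pow_Nil [simp]: "subst_word_pow \<theta> n [] = {[]}"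
  by (induction n) auto

lemma subst_word_pow_append:
  "subst_word_pow \<theta> n (u @ v) = {x @ y |x y. x \<in> subst_word_pow \<theta> n u \<and> y \<in> subst_word_pow \<theta> n v}"
proof (induction n)
  case (Suc n)
  show ?case unfolding subst_word_pow.simps Suc by (fastforce simp: subst_word_append)
qed simp

lemma subst_word_pow_appendI:
  "x \<in> subst_word_pow \<theta> n u \<Longrightarrow> y \<in> subst_word_pow \<theta> n v \<Longrightarrow> x @ y \<in> subst_word_pow \<theta> n (u @ v)"
  by (auto simp: subst_word_pow_append)

lemma subst_word_pow_add:
  "subst_word_pow \<theta> (m + n) u = (\<Union>v\<in>subst_word_pow \<theta> m u. subst_word_pow \<theta> n v)"
  by (induction n) auto

lemma subst_word_pow_chain:
  assumes "w \<in> subst_word_pow \<theta> k u"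
  shows "\<exists>z. z 0 = w \<and> z k = u \<and> (\<forall>i<k. z i \<in> subst_word \<theta> (z (Suc i)))"
  using assms
proof (induction k arbitrary: w)
  case 0
  then show ?case by (intro exI[of _ "\<lambda>_. u"]) simp
next
  case (Suc k)
  then obtain v where v: "v \<in> subst_word_pow \<theta> k u" "w \<in> subst_word \<theta> v" by auto
  obtain z where "z 0 = v" "z k = u" "\<forall>i<k. z i \<in> subst_word \<theta> (z (Suc i))" using Suc.IH[OF v(1)] by blast
  then show ?case using v by (intro exI[of _ "case_nat w z"]) (auto simp: less_Suc_eq_0_disj)
qed

lemma chain_subst_word_pow:
  assumes "\<And>i. i < k \<Longrightarrow> z i \<in> subst_word \<theta> (z (Suc i))" "i \<le> j" "j \<le> k"
  shows "z i \<in> subst_word_pow \<theta> (j - i) (z j)"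
proof -
  have "z (j - d) \<in> subst_word_pow \<theta> d (z j)" if "d \<le> j" for d
    using that
  proof (induction d)
    case (Suc d)
    have "z (j - Suc d) \<in> subst_word \<theta> (z (Suc (j - Suc d)))" using Suc.prems assms by (intro assms) auto
    then show ?case using Suc by (auto simp: Suc_diff_Suc)
  qed simp
  from this[of "j - i"] show ?thesis using assms by simp
qed

lemma subst_word_nonempty: "random_substitution \<theta> \<Longrightarrow> subst_word \<theta> u \<noteq> {}"
  by (induction u) (auto simp: subst_word_Cons random_substitution_def)

lemma subst_word_pow_nonempty: "random_substitution \<theta> \<Longrightarrow> subst_word_pow \<theta> n u \<noteq> {}"
  by (induction n) (auto simp: subst_word_nonempty)

lemma length_subst_word: "random_substitution \<theta> \<Longrightarrow> w \<in> subst_word \<theta> u \<Longrightarrow> length u \<le> length w"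
proof (induction u arbitrary: w)
  case (Cons a u)
  then obtain x y where "w = x @ y" "x \<in> \<theta> a" "y \<in> subst_word \<theta> u" by (auto simp: subst_word_Cons)
  moreover have "x \<noteq> []" using \<open>x \<in> \<theta> a\<close> Cons.prems(1) by (auto simp: random_substitution_def)
  ultimately show ?case using Cons by (cases x) fastforce+
qed simp

lemma length_subst_word_pow:
  "random_substitution \<theta> \<Longrightarrow> w \<in> subst_word_pow \<theta> n u \<Longrightarrow> length u \<le> length w"
  by (induction n arbitrary: w) (auto dest: length_subst_word intro: order_trans)

lemma legal_sublist: "legal \<theta> u \<Longrightarrow> sublist v u \<Longrightarrow> legal \<theta> v"
  unfolding legal_def by (meson sublist_order.order_trans)

lemma legal_pow_letter: "v \<in> subst_word_pow \<theta> k [a] \<Longrightarrow> legal \<theta> v"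
  unfolding legal_def by blast

text \<open>
  The version of \<open>subst_word_letter_ancestor\<close> for sequences. Realisations are non-empty, so the
  images of the first \<open>n + 1\<close> letters of \<open>x\<close> already cover the position \<open>n\<close> of \<open>y\<close>.
\<close>
lemma subst_seq_prefix_ancestor:
  assumes rs: "random_substitution \<theta>" and y: "y \<in> subst_seq \<theta> x"
  shows "\<exists>m q p s. map y [0..<n] = q @ p \<and> q \<in> subst_word \<theta> (map x [0..<m]) \<and> p @ [y n] @ s \<in> \<theta> (x m)"
proof -
  obtain v where v: "\<And>i. v i \<in> \<theta> (x i)"
    and pre: "\<And>n. map y [0..<length (concat (map v [0..<n]))] = concat (map v [0..<n])"
    using y by (auto simp: subst_seq_def Let_def)
  define c where "c = concat (map v [0..<Suc n])"
  have c: "c \<in> subst_word \<theta> (map x [0..<Suc n])"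
    unfolding c_def subst_word_def using v by (auto simp: list_all2_conv_all_nth simp del: upt_Suc intro!: exI[of _ "map v [0..<Suc n]"])
  then have len: "n < length c" using length_subst_word[OF rs c] by simp
  have "map y [0..<length c] = c" unfolding c_def by (rule pre)
  moreover have "[0..<length c] = [0..<n] @ [n] @ [Suc n..<length c]"
    using len by (metis append_Cons append_Nil upt_add_eq_append upt_conv_Cons less_imp_add_positive add_0 le_add1 nless_le)
  ultimately have eq: "c = map y [0..<n] @ [y n] @ map y [Suc n..<length c]" by (metis list.simps(8,9) map_append)
  then have "map y [0..<n] @ [y n] @ map y [Suc n..<length c] \<in> subst_word \<theta> (map x [0..<Suc n])" using c by simp
  from subst_word_letter_ancestor[OF this] obtain q b r q' p' s' where
    d: "map x [0..<Suc n] = q @ [b] @ r" "q' \<in> subst_word \<theta> q" "map y [0..<n] = q' @ p'" "p' @ [y n] @ s' \<in> \<theta> b"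
    by blast
  have lq: "length q < Suc n" using arg_cong[OF d(1), of length] by simp
  have "q = take (length q) (map x [0..<Suc n])" unfolding d(1) by simp
  also have "\<dots> = map x [0..<length q]" using lq by (simp add: take_map del: upt_Suc)
  finally have "q = map x [0..<length q]" .
  moreover have "b = map x [0..<Suc n] ! length q" unfolding d(1) by simp
  then have "b = x (length q)" using lq by (simp del: upt_Suc)
  ultimately show ?thesis using d by metis
qed

section \<open>Abelianisation\<close>

lemma abel_Nil [simp]: "abel [] = 0"
  by (simp add: abel_def vec_eq_iff)

lemma abel_append [simp]: "abel (u @ v) = abel u + abel v"
  by (simp add: abel_def vec_eq_iff)

lemma abel_subst_word:
  assumes c: "compatible \<theta>" and rs: "random_substitution \<theta>"
  shows "w \<in> subst_word \<theta> u \<Longrightarrow> abel w = subst_matrix \<theta> *v abel u"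
proof (induction u arbitrary: w)
  case (Cons a u)
  then obtain x y where xy: "w = x @ y" "x \<in> \<theta> a" "y \<in> subst_word \<theta> u" by (auto simp: subst_word_Cons)
  have "(SOME v. v \<in> \<theta> a) \<in> \<theta> a" using rs by (simp add: random_substitution_def some_in_eq)
  then have "abel x = abel (SOME v. v \<in> \<theta> a)" using c xy(2) unfolding compatible_def by blast
  also have "\<dots> = subst_matrix \<theta> *v axis a 1"
    unfolding matrix_vector_mult_basis column_def by (simp add: abel_def subst_matrix_def)
  also have "axis a 1 = abel [a]" by (auto simp add: abel_def vec_eq_iff axis_def)
  finally have "abel w = subst_matrix \<theta> *v abel ([a] @ u)"
    using Cons.IH[OF xy(3)] by (simp only: xy(1) abel_append matrix_vector_right_distrib)
  then show ?case by (simp only: append_Cons append_Nil)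
next
  case Nil
  then show ?case by (simp only: subst_word_Nil singleton_iff abel_Nil matrix_vector_mult_0_right)
qed

lemma abel_subst_word_pow:
  assumes "compatible \<theta>" and "random_substitution \<theta>"
  shows "w \<in> subst_word_pow \<theta> n u \<Longrightarrow> abel w = ((*v) (subst_matrix \<theta>) ^^ n) (abel u)"
proof (induction n arbitrary: w)
  case (Suc n)
  then obtain v where v: "v \<in> subst_word_pow \<theta> n u" "w \<in> subst_word \<theta> v" by auto
  show ?case by (simp only: abel_subst_word[OF assms v(2)] Suc.IH[OF v(1)] funpow.simps o_apply)
next
  case 0
  then show ?case by (simp only: subst_word_pow.simps singleton_iff funpow.simps id_apply)
qed

section \<open>Contraction on the hyperplane\<close>

locale pisot_substitution =
  fixes \<theta> :: "'n::finite \<Rightarrow> 'n list set" and L R :: "real ^ 'n"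
  assumes rs: "random_substitution \<theta>" and comp: "compatible \<theta>"
    and pisot: "irreducible_pisot \<theta>"
    and left: "left_pf_eigenvector (subst_matrix \<theta>) L"
    and right: "right_pf_eigenvector (subst_matrix \<theta>) R"
begin

definition M :: "real ^ 'n ^ 'n" where "M = subst_matrix \<theta>"

definition Mpow :: "nat \<Rightarrow> real ^ 'n \<Rightarrow> real ^ 'n" where "Mpow n = ((*v) M) ^^ n"

lemma Mpow_0 [simp]: "Mpow 0 x = x" and Mpow_Suc: "Mpow (Suc n) x = M *v Mpow n x"
  by (simp_all add: Mpow_def)

lemma Mpow_add: "Mpow (m + n) x = Mpow m (Mpow n x)"
  by (simp add: Mpow_def funpow_add)

lemma linear_Mpow: "linear (Mpow n)"
proof (induction n)
  case (Suc n)
  have "Mpow (Suc n) = (*v) M \<circ> Mpow n" by (simp add: fun_eq_iff Mpow_Suc)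
  then show ?case using linear_compose[OF Suc matrix_vector_mul_linear, of M] by metis
qed (simp add: Mpow_def id_def[symmetric] linear_id)

lemma pisot_data:
  obtains l where "pf_eigenvalue M l" "1 < l" "M *v R = l *\<^sub>R R" "L v* M = l *\<^sub>R L"
    "pisot_number l"
proof -
  obtain l where l: "pf_eigenvalue M l" "1 < l"
    using pisot by (auto simp: irreducible_pisot_def primitive_subst_def M_def)
  have eq: "k = l" if "pf_eigenvalue M k" for k using pf_eigenvalue_unique that l(1) by blast
  have "pisot_number l" using pisot eq unfolding irreducible_pisot_def M_def by blast
  moreover have "M *v R = l *\<^sub>R R" using right eq unfolding right_pf_eigenvector_def M_def by blast
  moreover have "L v* M = l *\<^sub>R L" using left eq unfolding left_pf_eigenvector_def M_def by blast
  ultimately show thesis using that l by blast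
qed

definition lam :: real where "lam = (THE l. pf_eigenvalue M l)"

lemma lam: "pf_eigenvalue M lam" "1 < lam" "M *v R = lam *\<^sub>R R" "L v* M = lam *\<^sub>R L" "pisot_number lam"
proof -
  obtain l where l: "pf_eigenvalue M l" "1 < l" "M *v R = l *\<^sub>R R" "L v* M = l *\<^sub>R L" "pisot_number l"
    by (rule pisot_data)
  have "lam = l" unfolding lam_def using l(1) pf_eigenvalue_unique by blast
  with l show "pf_eigenvalue M lam" "1 < lam" "M *v R = lam *\<^sub>R R" "L v* M = lam *\<^sub>R L" "pisot_number lam"
    by simp_all
qed

lemma L_pos: "0 < L $ i" and R_pos: "0 < R $ i"
  using left right by (simp_all add: left_pf_eigenvector_def right_pf_eigenvector_def)

lemma L_R_pos: "0 < L \<bullet> R"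
  unfolding inner_vec_def by (rule sum_pos) (auto simp: L_pos R_pos)

lemma inner_L_M: "L \<bullet> (M *v x) = lam * (L \<bullet> x)"
  by (rule inner_mult_vec_left_eigenvector[OF lam(4)])

lemma summable_Mpow:
  assumes x: "L \<bullet> x = 0"
  shows "summable (\<lambda>n. norm (Mpow n x))"
  unfolding Mpow_def
proof (rule summable_iterates_hyperplane[OF lam(4) x])
  fix v :: "complex ^ 'n" and c
  assume v: "v \<noteq> 0" "complexify M *v v = c *s v" and H: "(\<Sum>i\<in>UNIV. of_real (L $ i) * v $ i) = 0"
  let ?Z = "subst_matrix \<theta> :: int ^ 'n ^ 'n"
  have Z: "(\<chi> i j. real_of_int (?Z $ i $ j)) = M" "(\<chi> i j. of_int (?Z $ i $ j)) = complexify M"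
    by (simp_all add: M_def subst_matrix_def vec_eq_iff)
  have prim: "primitive_matrix M" using pisot by (simp add: irreducible_pisot_def primitive_subst_def M_def)
  have "c \<noteq> of_real lam"
  proof
    assume c: "c = of_real lam"
    have zero: "u = 0" if "M *v u = lam *\<^sub>R u" "L \<bullet> u = 0" for u
      using pf_eigenvector_in_hyperplane_eq_0[OF prim L_pos _ lam(4) that] lam(2) by simp
    have re: "M *v (\<chi> i. Re (v $ i)) = lam *\<^sub>R (\<chi> i. Re (v $ i))"
      using arg_cong[OF v(2), of "\<lambda>w. \<chi> i. Re (w $ i)"]
      by (simp add: c vec_eq_iff matrix_vector_mult_def)
    have im: "M *v (\<chi> i. Im (v $ i)) = lam *\<^sub>R (\<chi> i. Im (v $ i))"
      using arg_cong[OF v(2), of "\<lambda>w. \<chi> i. Im (w $ i)"]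
      by (simp add: c vec_eq_iff matrix_vector_mult_def)
    have "L \<bullet> (\<chi> i. Re (v $ i)) = 0" "L \<bullet> (\<chi> i. Im (v $ i)) = 0"
      using arg_cong[OF H, of Re] arg_cong[OF H, of Im] by (simp_all add: inner_vec_def)
    then have "(\<chi> i. Re (v $ i)) = 0" "(\<chi> i. Im (v $ i)) = 0" using zero re im by blast+
    then show False using v(1) by (simp add: vec_eq_iff complex_eq_iff)
  qed
  then show "cmod c < 1"
    using irreducible_pisot_eigenvalue_bound[of ?Z lam v c] v Z lam pisot
    by (simp add: irreducible_pisot_def pf_eigenvalue_def)
qed

lemma linear_proj: "linear (proj L R)"
  by (rule linearI) (simp_all add: proj_def inner_add_right algebra_simps add_divide_distrib scaleR_add_left)

lemma inner_L_proj [simp]: "L \<bullet> proj L R x = 0"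
  using L_R_pos by (simp add: proj_def inner_diff_right)

lemma proj_id: "L \<bullet> x = 0 \<Longrightarrow> proj L R x = x"
  by (simp add: proj_def)

lemma proj_M: "proj L R (M *v x) = M *v proj L R x"
  by (simp add: proj_def inner_L_M matrix_vector_mult_diff_distrib matrix_vector_mult_scaleR lam(3))

lemma proj_Mpow: "proj L R (Mpow n x) = Mpow n (proj L R x)"
  by (induction n) (simp_all add: Mpow_Suc proj_M)

text \<open>
  A bound for the operator norm of \<open>M\<^sup>n\<close> on the hyperplane, as \<open>norm_Mpow_le\<close> shows. The sum over a
  basis reduces its convergence to that of the single orbits.
\<close>
definition contraction :: "nat \<Rightarrow> real" where
  "contraction n = (\<Sum>i\<in>Basis. norm (Mpow n (proj L R i)))"

lemma contraction_nonneg: "0 \<le> contraction n"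
  unfolding contraction_def by (rule sum_nonneg) simp

lemma contraction_tendsto_0: "contraction \<longlonglongrightarrow> 0"
proof -
  have "summable contraction" unfolding contraction_def[abs_def]
    by (intro summable_sum summable_Mpow) simp
  then show ?thesis by (rule summable_LIMSEQ_zero)
qed

lemma norm_Mpow_le:
  assumes "L \<bullet> x = 0"
  shows "norm (Mpow n x) \<le> contraction n * norm x"
proof -
  have lin: "linear (\<lambda>x. Mpow n (proj L R x))"
    using linear_compose[OF linear_proj linear_Mpow] by (simp add: o_def)
  have "Mpow n x = Mpow n (proj L R x)" using assms by (simp add: proj_id)
  also have "\<dots> = Mpow n (proj L R (\<Sum>i\<in>Basis. (x \<bullet> i) *\<^sub>R i))" by (simp add: euclidean_representation)
  also have "\<dots> = (\<Sum>i\<in>Basis. (x \<bullet> i) *\<^sub>R Mpow n (proj L R i))"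
    by (simp add: linear_sum[OF lin] linear_cmul[OF lin])
  finally have "norm (Mpow n x) \<le> (\<Sum>i\<in>Basis. norm ((x \<bullet> i) *\<^sub>R Mpow n (proj L R i)))"
    using norm_sum by metis
  also have "\<dots> \<le> (\<Sum>i\<in>Basis. norm x * norm (Mpow n (proj L R i)))"
    by (rule sum_mono) (simp add: mult_right_mono Basis_le_norm)
  finally show ?thesis by (simp add: contraction_def sum_distrib_left mult.commute)
qed

section \<open>Projections of words\<close>

definition pt :: "'n list \<Rightarrow> real ^ 'n" where "pt u = proj L R (abel u)"

lemma pt_Nil [simp]: "pt [] = 0"
  by (simp add: pt_def proj_def)

lemma pt_append [simp]: "pt (u @ v) = pt u + pt v"
  by (simp add: pt_def linear_add[OF linear_proj])

lemma inner_L_pt [simp]: "L \<bullet> pt u = 0"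
  by (simp add: pt_def)

lemma abel_pow: "w \<in> subst_word_pow \<theta> n u \<Longrightarrow> abel w = Mpow n (abel u)"
  unfolding Mpow_def M_def by (rule abel_subst_word_pow[OF comp rs])

lemma pt_pow: "w \<in> subst_word_pow \<theta> n u \<Longrightarrow> pt w = Mpow n (pt u)"
  unfolding pt_def by (metis abel_pow proj_Mpow)

lemma pt_subst_word: "w \<in> subst_word \<theta> u \<Longrightarrow> pt w = M *v pt u"
  unfolding pt_def M_def by (metis abel_subst_word[OF comp rs] proj_M M_def)

text \<open>
  From \<open>M\<^sup>K > 0\<close> this is clear for \<open>n = K\<close>. A realisation of \<open>\<theta>\<^sup>n(a)\<close> with \<open>n \<ge> K\<close> contains a
  realisation of \<open>\<theta>\<^sup>K(c)\<close> for some letter \<open>c\<close>.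
\<close>
lemma eventually_all_letters: "\<exists>K. \<forall>n\<ge>K. \<forall>a b. \<forall>v\<in>subst_word_pow \<theta> n [a]. b \<in> set v"
proof -
  obtain K where K: "\<And>i j. 0 < mat_pow M K $ i $ j"
    using pisot by (auto simp: irreducible_pisot_def primitive_subst_def primitive_matrix_def M_def)
  have now: "b \<in> set v" if v: "v \<in> subst_word_pow \<theta> K [a]" for a b v
  proof -
    have "abel [a] = axis a 1" by (auto simp: abel_def vec_eq_iff axis_def)
    then have "abel v = mat_pow M K *v axis a 1" using abel_pow[OF v] by (simp add: mat_pow_mult_vec Mpow_def)
    then have "real (count_list v b) = mat_pow M K $ b $ a"
      by (simp add: matrix_vector_mult_basis column_def abel_def vec_eq_iff)
    then have "0 < real (count_list v b)" using K by simp
    then show ?thesis by (metis count_notin of_nat_0 less_irrefl)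
  qed
  have "b \<in> set v" if n: "K \<le> n" and v: "v \<in> subst_word_pow \<theta> n [a]" for n a b v
  proof -
    obtain u where u: "u \<in> subst_word_pow \<theta> (n - K) [a]" "v \<in> subst_word_pow \<theta> K u"
      using v subst_word_pow_add[of \<theta> "n - K" K "[a]"] n by auto
    have "u \<noteq> []" using length_subst_word_pow[OF rs u(1)] by auto
    then obtain c u' where "u = [c] @ u'" by (cases u) auto
    then obtain x y where "v = x @ y" "x \<in> subst_word_pow \<theta> K [c]" using u(2) subst_word_pow_append by blast
    then show ?thesis using now by auto
  qed
  then show ?thesis by blast
qed

section \<open>The self-consistency operator\<close>

definition subdivide :: "('n \<Rightarrow> (real ^ 'n) set) \<Rightarrow> 'n \<Rightarrow> (real ^ 'n) set" where
  "subdivide T a = {M *v y + pt p |b p s y. p @ [a] @ s \<in> \<theta> b \<and> y \<in> T b}"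

lemma subdivide_I: "p @ [a] @ s \<in> \<theta> b \<Longrightarrow> y \<in> T b \<Longrightarrow> M *v y + pt p \<in> subdivide T a"
  unfolding subdivide_def by blast

lemma subdivide_mono: "T \<le> T' \<Longrightarrow> subdivide T \<le> subdivide T'"
  unfolding subdivide_def le_fun_def by blast

lemma self_consistent_iff: "self_consistent \<theta> L R T \<longleftrightarrow> subdivide T = T"
proof -
  have "(\<Union>b. \<Union>(p, c, s) \<in> {(p, c, s) \<in> decompositions \<theta>. c = a \<and> p @ [a] @ s \<in> \<theta> b}.
        (\<lambda>x. x + proj L R (abel p)) ` (hyp_map \<theta> ` T b)) = subdivide T a" for a
    unfolding subdivide_def decompositions_def hyp_map_def pt_def M_def by blast
  then show ?thesis unfolding self_consistent_def fun_eq_iff by metis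
qed

text \<open>
  Iterating the operator for \<open>\<theta>\<close> amounts to applying once the operator for \<open>\<theta>\<^sup>n\<close>. This is how
  inclusions between families become statements about words.
\<close>
lemma subdivide_iter_iff:
  "z \<in> (subdivide ^^ n) T a \<longleftrightarrow> (\<exists>b p s y. p @ [a] @ s \<in> subst_word_pow \<theta> n [b] \<and> y \<in> T b \<and> z = Mpow n y + pt p)"
proof (induction n arbitrary: z a)
  case 0
  have "p @ [a] @ s = [b] \<longleftrightarrow> p = [] \<and> s = [] \<and> a = b" for p s b by (auto simp: append_eq_Cons_conv)
  then show ?case by auto
next
  case (Suc n)
  have lin: "M *v (x + y) = M *v x + M *v y" for x y by (rule matrix_vector_right_distrib)
  show ?case
  proof
    assume "z \<in> (subdivide ^^ Suc n) T a"
    then obtain c p s y where 1: "z = M *v y + pt p" "p @ [a] @ s \<in> \<theta> c" "y \<in> (subdivide ^^ n) T c"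
      by (auto simp: subdivide_def)
    then obtain b p' s' y' where 2: "p' @ [c] @ s' \<in> subst_word_pow \<theta> n [b]" "y' \<in> T b" "y = Mpow n y' + pt p'"
      using Suc.IH by blast
    obtain P S where PS: "P \<in> subst_word \<theta> p'" "S \<in> subst_word \<theta> s'"
      using subst_word_nonempty[OF rs] by blast
    have "P @ (p @ [a] @ s) @ S \<in> subst_word \<theta> (p' @ [c] @ s')"
      using PS 1 by (intro subst_word_appendI) simp_all
    then have "(P @ p) @ [a] @ (s @ S) \<in> subst_word_pow \<theta> (Suc n) [b]" using 2(1) by auto
    moreover have "z = Mpow (Suc n) y' + pt (P @ p)"
      by (simp add: 1 2 Mpow_Suc lin pt_subst_word[OF PS(1)])
    ultimately show "\<exists>b p s y. p @ [a] @ s \<in> subst_word_pow \<theta> (Suc n) [b] \<and> y \<in> T b \<and> z = Mpow (Suc n) y + pt p"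
      using 2(2) by blast
  next
    assume "\<exists>b p s y. p @ [a] @ s \<in> subst_word_pow \<theta> (Suc n) [b] \<and> y \<in> T b \<and> z = Mpow (Suc n) y + pt p"
    then obtain b p s y u where 1: "p @ [a] @ s \<in> subst_word \<theta> u" "u \<in> subst_word_pow \<theta> n [b]" "y \<in> T b"
      "z = Mpow (Suc n) y + pt p" by auto
    from subst_word_letter_ancestor[OF 1(1)] obtain q c r q' p' s' where
      2: "u = q @ [c] @ r" "q' \<in> subst_word \<theta> q" "p = q' @ p'" "p' @ [a] @ s' \<in> \<theta> c" by blast
    have "Mpow n y + pt q \<in> (subdivide ^^ n) T c" using Suc.IH 1 2 by blast
    then have "M *v (Mpow n y + pt q) + pt p' \<in> subdivide ((subdivide ^^ n) T) a" using 2(4) subdivide_I by blast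
    then show "z \<in> (subdivide ^^ Suc n) T a" using 1 2 by (simp add: lin Mpow_Suc pt_subst_word add.assoc)
  qed
qed

lemma subdivide_as_finite_union:
  "subdivide T a = (\<Union>b. \<Union>p\<in>{p. \<exists>s. p @ [a] @ s \<in> \<theta> b}. (\<lambda>y. M *v y + pt p) ` T b)"
  unfolding subdivide_def by blast

lemma finite_decompositions: "finite {p. \<exists>s. p @ [a] @ s \<in> \<theta> b}"
proof (rule finite_subset)
  show "{p. \<exists>s. p @ [a] @ s \<in> \<theta> b} \<subseteq> (\<Union>v\<in>\<theta> b. (\<lambda>n. take n v) ` {..length v})"
  proof
    fix p assume "p \<in> {p. \<exists>s. p @ [a] @ s \<in> \<theta> b}"
    then obtain s where s: "p @ [a] @ s \<in> \<theta> b" by blast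
    then show "p \<in> (\<Union>v\<in>\<theta> b. (\<lambda>n. take n v) ` {..length v})"
      by (intro UN_I[OF s] image_eqI[of _ _ "length p"]) auto
  qed
  show "finite (\<Union>v\<in>\<theta> b. (\<lambda>n. take n v) ` {..length v})"
    using rs by (auto simp: random_substitution_def)
qed

lemma compact_subdivide:
  assumes "\<And>b. compact (T b)"
  shows "compact (subdivide T a)"
proof -
  have "continuous_on S (\<lambda>y. M *v y + pt p)" for S p
    by (intro continuous_on_add continuous_on_const matrix_vector_mult_linear_continuous_on)
  then have "compact ((\<lambda>y. M *v y + pt p) ` T b)" for p b
    by (rule compact_continuous_image) (rule assms)
  then show ?thesis unfolding subdivide_as_finite_union by (intro compact_UN finite_decompositions) simp_all
qed

lemma compact_subdivide_iter: "(\<And>b. compact (T b)) \<Longrightarrow> compact ((subdivide ^^ n) T a)"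
  by (induction n arbitrary: a) (simp_all add: compact_subdivide)

end

section \<open>Limits of words\<close>

lemma prefix_chain_limit:
  fixes c :: "nat \<Rightarrow> 'b list"
  assumes chain: "\<And>n. prefix (c n) (c (Suc n))" and unb: "\<And>i. \<exists>n. i < length (c n)"
  shows "\<exists>x. \<forall>n. map x [0..<length (c n)] = c n"
proof -
  have mono: "prefix (c m) (c n)" if "m \<le> n" for m n
    using that by (induction rule: dec_induct) (auto intro: chain prefix_order.order_trans)
  have nth: "c m ! i = c n ! i" if "i < length (c m)" "i < length (c n)" for i m n
  proof (cases "m \<le> n")
    case True
    then show ?thesis using mono[OF True] that by (auto simp: prefix_def nth_append)
  next
    case False
    then show ?thesis using mono[of n m] that by (auto simp: prefix_def nth_append)
  qed
  define x where "x i = c (SOME n. i < length (c n)) ! i" for i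
  have "x i = c n ! i" if "i < length (c n)" for i n
    unfolding x_def using someI_ex[OF unb[of i]] that by (rule nth)
  then have "map x [0..<length (c n)] = c n" for n by (intro nth_equalityI) simp_all
  then show ?thesis by blast
qed

lemma prefix_map_upt:
  assumes "prefix c (map y [0..<N])"
  shows "map y [0..<length c] = c"
proof -
  have "length c \<le> N" using prefix_length_le[OF assms] by simp
  then have "map y [0..<length c] = take (length c) (map y [0..<N])" by (simp add: take_map)
  also have "\<dots> = c" using assms by (auto simp: prefix_def)
  finally show ?thesis .
qed

text \<open>
  Each step only appends, and \<open>w\<close> is a realisation of \<open>z\<close> alone. So the realisations chosen for the
  letters of \<open>Z n\<close> are never revised, and they pass to the limit without a compactness argument.
\<close>
lemma subst_seq_limit:
  assumes start: "W 0 \<in> subst_word \<theta> (Z 0)"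
    and step: "\<And>n. \<exists>w z. W (Suc n) = W n @ w \<and> Z (Suc n) = Z n @ z \<and> w \<in> subst_word \<theta> z"
    and W: "\<And>n. map y [0..<length (W n)] = W n" and Z: "\<And>n. map x [0..<length (Z n)] = Z n"
    and unb: "\<And>i. \<exists>n. i < length (Z n)"
  shows "y \<in> subst_seq \<theta> x"
proof -
  let ?real = "\<lambda>vs u. list_all2 (\<lambda>v a. v \<in> \<theta> a) vs u"
  obtain d0 where d0: "?real d0 (Z 0)" "concat d0 = W 0"
    using start by (auto simp: subst_word_def)
  have "\<forall>n. \<exists>d z. W (Suc n) = W n @ concat d \<and> Z (Suc n) = Z n @ z \<and> ?real d z"
    using step by (auto simp: subst_word_def) metis
  then obtain d z where d: "\<And>n. W (Suc n) = W n @ concat (d n)" "\<And>n. Z (Suc n) = Z n @ z n"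
    "\<And>n. ?real (d n) (z n)" by metis
  define c where "c n = d0 @ concat (map d [0..<n])" for n
  have c_Suc: "c (Suc n) = c n @ d n" for n by (simp add: c_def)
  have cW: "concat (c n) = W n" for n
    by (induction n) (simp_all add: c_Suc d d0, simp add: c_def d0)
  have cZ: "?real (c n) (Z n)" for n
  proof (induction n)
    case 0
    then show ?case by (simp add: c_def d0)
  next
    case (Suc n)
    then show ?case by (simp add: c_Suc d list_all2_appendI)
  qed
  have len: "length (c n) = length (Z n)" for n using cZ by (rule list_all2_lengthD)
  obtain v where v: "\<And>n. map v [0..<length (c n)] = c n"
    using prefix_chain_limit[of c] unb by (auto simp: c_Suc len)
  have "v i \<in> \<theta> (x i)" for i
  proof -
    obtain n where n: "i < length (Z n)" using unb by blast
    then have "c n ! i \<in> \<theta> (Z n ! i)" using cZ[of n] len by (simp add: list_all2_conv_all_nth)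
    moreover have "c n ! i = v i" using n len by (metis v nth_map_upt add_0 diff_zero)
    moreover have "Z n ! i = x i" using n by (metis Z nth_map_upt add_0 diff_zero)
    ultimately show ?thesis by simp
  qed
  moreover have "map y [0..<length (concat (map v [0..<k]))] = concat (map v [0..<k])" for k
  proof -
    obtain n where n: "k < length (Z n)" using unb by blast
    have "[0..<length (c n)] = [0..<k] @ [k..<length (c n)]"
      using n len by (metis upt_add_eq_append le0 le_add_diff_inverse less_imp_le)
    then have "W n = concat (map v [0..<k]) @ concat (map v [k..<length (c n)])"
      by (metis cW v map_append concat_append)
    then have "prefix (concat (map v [0..<k])) (map y [0..<length (W n)])" using W by (metis prefixI)
    then show ?thesis by (rule prefix_map_upt)
  qed
  ultimately show ?thesis by (auto simp: subst_seq_def Let_def)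
qed

text \<open>
  A schedule in which every request \<open>x\<close> comes up at arbitrarily late times in \<open>G\<close>: the second
  component of the decoded pair is free and makes the time as late as desired.
\<close>
lemma infinitely_recurrent_enumeration:
  fixes G :: "nat set"
  assumes "infinite G"
  shows "\<exists>r :: nat \<Rightarrow> 'a::countable. \<forall>x N. \<exists>n\<in>G. N \<le> n \<and> r n = x"
proof -
  have inj: "inj (enumerate G)" using assms by (simp add: strict_mono_enumerate strict_mono_imp_inj_on)
  define r :: "nat \<Rightarrow> 'a" where "r n = from_nat (fst (prod_decode (inv (enumerate G) n)))" for n
  have "\<exists>n\<in>G. N \<le> n \<and> r n = x" for x N
  proof -
    (* the time with index k in G is at least k, and k is at least N *)
    let ?k = "prod_encode (to_nat x, N)"
    have "N \<le> ?k" by (rule le_prod_encode_2)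
    also have "?k \<le> enumerate G ?k" by (rule le_enumerate[OF assms])
    finally show ?thesis
      using assms inj by (intro bexI[of _ "enumerate G ?k"]) (simp_all add: enumerate_in_set r_def)
  qed
  then show ?thesis by blast
qed

lemma periodic_point_exists:
  fixes f :: "'a::finite \<Rightarrow> 'a"
  shows "\<exists>a k. 0 < k \<and> (f ^^ k) a = a"
proof -
  have "\<not> inj (\<lambda>n. (f ^^ n) undefined)"
    using finite_imageD[of "\<lambda>n. (f ^^ n) undefined" UNIV] infinite_UNIV_nat by auto
  then obtain i j where "i < j" "(f ^^ i) undefined = (f ^^ j) undefined"
    unfolding inj_def by (metis linorder_neqE_nat)
  then have "(f ^^ (j - i)) ((f ^^ i) undefined) = (f ^^ i) undefined"
    by (metis comp_apply funpow_add less_imp_le le_add_diff_inverse2)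
  then show ?thesis using \<open>i < j\<close> by (metis zero_less_diff)
qed

context pisot_substitution
begin

lemma subdivide_E:
  assumes "z \<in> subdivide T a"
  obtains b p s y where "z = M *v y + pt p" "p @ [a] @ s \<in> \<theta> b" "y \<in> T b"
  using assms unfolding subdivide_def by blast

section \<open>Bounded discrepancy of legal words\<close>

text \<open>
  For a proper prefix \<open>p\<close> of a realisation of \<open>\<theta>\<^sup>n(b)\<close> the point \<open>pt p\<close> lies in the \<open>n\<close>-th subdivision of
  the family \<open>{0}\<close>, so it is a sum of terms \<open>M\<^sup>k e\<^sub>k\<close> with \<open>k < n\<close> and \<open>e\<^sub>k\<close> in a finite set \<open>E\<close>. The orbits
  of the elements of \<open>E\<close> are summable, which bounds these points independently of \<open>n\<close>. Every
  non-empty prefix of a realisation is a proper one followed by a letter, and a legal word is what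
  remains of a prefix after the removal of a shorter one.
\<close>
lemma legal_points_bounded: "\<exists>C. \<forall>u. legal \<theta> u \<longrightarrow> norm (pt u) \<le> C"
proof -
  define E where "E = pt ` (\<Union>a b. {p. \<exists>s. p @ [a] @ s \<in> \<theta> b})"
  have finE: "finite E" unfolding E_def by (intro finite_imageI finite_UN_I finite finite_decompositions)
  (* the total contribution of level k, over all possible choices *)
  define S where "S k = (\<Sum>e\<in>E. norm (Mpow k e))" for k
  have summ: "summable S" unfolding S_def[abs_def]
    by (intro summable_sum summable_Mpow) (auto simp: E_def)
  have iter: "norm (Mpow j z) \<le> (\<Sum>k<n. S (j + k))" if "z \<in> (subdivide ^^ n) (\<lambda>_. {0}) a" for n z j a
    using that
  proof (induction n arbitrary: z j a)
    case 0
    then show ?case using linear_0[OF linear_Mpow] by simp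
  next
    case (Suc n)
    then have "z \<in> subdivide ((subdivide ^^ n) (\<lambda>_. {0})) a" by simp
    then obtain b p s y where z: "z = M *v y + pt p" "p @ [a] @ s \<in> \<theta> b" "y \<in> (subdivide ^^ n) (\<lambda>_. {0}) b"
      by (rule subdivide_E)
    have e: "pt p \<in> E" unfolding E_def using z(2) by blast
    have "Mpow j z = Mpow (Suc j) y + Mpow j (pt p)"
      using Mpow_add[of j 1 y] by (simp add: z linear_add[OF linear_Mpow] Mpow_Suc)
    also have "norm \<dots> \<le> norm (Mpow (Suc j) y) + norm (Mpow j (pt p))" by (rule norm_triangle_ineq)
    also have "norm (Mpow (Suc j) y) \<le> (\<Sum>k<n. S (Suc j + k))" by (rule Suc.IH[OF z(3)])
    also have "norm (Mpow j (pt p)) \<le> S j" unfolding S_def by (rule member_le_sum[OF e]) (simp_all add: finE)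
    finally show ?case by (simp add: sum.lessThan_Suc_shift del: sum.lessThan_Suc)
  qed
  define B where "B = (\<Sum>k. S k) + (\<Sum>c\<in>UNIV. norm (pt [c]))"
  have B: "norm (pt q) \<le> B" if v: "v \<in> subst_word_pow \<theta> n [b]" "prefix q v" for q v n b
  proof (cases q rule: rev_cases)
    case Nil
    have "0 \<le> (\<Sum>k. S k)" by (rule suminf_nonneg[OF summ]) (simp add: S_def sum_nonneg)
    then show ?thesis by (simp add: Nil B_def sum_nonneg)
  next
    case (snoc p c)
    then obtain s where "v = p @ [c] @ s" using v(2) by (auto simp: prefix_def)
    then have "pt p \<in> (subdivide ^^ n) (\<lambda>_. {0}) c"
      unfolding subdivide_iter_iff using v(1) linear_0[OF linear_Mpow] by auto
    from iter[OF this, of 0] have "norm (pt p) \<le> (\<Sum>k<n. S k)" by simp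
    also have "\<dots> \<le> (\<Sum>k. S k)" by (rule sum_le_suminf[OF summ]) (auto simp: S_def sum_nonneg)
    finally have "norm (pt p) \<le> (\<Sum>k. S k)" .
    moreover have "norm (pt [c]) \<le> (\<Sum>c\<in>UNIV. norm (pt [c]))" by (rule member_le_sum) auto
    ultimately show ?thesis using norm_triangle_ineq[of "pt p" "pt [c]"] by (simp add: snoc B_def)
  qed
  have "norm (pt u) \<le> 2 * B" if u: "legal \<theta> u" for u
  proof -
    obtain n b v x y where v: "v \<in> subst_word_pow \<theta> n [b]" "v = x @ u @ y"
      using u unfolding legal_def sublist_def by blast
    have "norm (pt (x @ u)) \<le> B" "norm (pt x) \<le> B"
      using B[OF v(1), of "x @ u"] B[OF v(1), of x] v(2) by (auto simp del: pt_append)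
    moreover have "norm (pt (x @ u) - pt x) \<le> norm (pt (x @ u)) + norm (pt x)" by (rule norm_triangle_ineq4)
    moreover have "norm (pt (x @ u) - pt x) = norm (pt u)" by simp
    ultimately show ?thesis by linarith
  qed
  then show ?thesis by blast
qed

definition discrepancy :: real where
  "discrepancy = (SOME C. \<forall>u. legal \<theta> u \<longrightarrow> norm (pt u) \<le> C)"

lemma norm_pt_legal: "legal \<theta> u \<Longrightarrow> norm (pt u) \<le> discrepancy"
  using someI_ex[OF legal_points_bounded] unfolding discrepancy_def by blast

section \<open>Construction of a generic sequence\<close>

lemma inner_L_pow:
  assumes "v \<in> subst_word_pow \<theta> n u"
  shows "L \<bullet> abel v = lam ^ n * (L \<bullet> abel u)"
proof -
  have "L \<bullet> Mpow n x = lam ^ n * (L \<bullet> x)" for x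
    by (induction n) (simp_all add: Mpow_Suc inner_L_M)
  then show ?thesis by (simp add: abel_pow[OF assms])
qed

text \<open>
  Pairing with \<open>L\<close> measures words so that \<open>\<theta>\<close> multiplies their size by \<open>\<lambda> > 1\<close>. A letter that is a
  realisation of \<open>\<theta>\<^sup>n\<close> of a letter for all \<open>n\<close> would have unbounded size.
\<close>
lemma not_all_images_letters:
  assumes z: "\<And>i. [A i] \<in> \<theta> (A (Suc i))"
  shows False
proof -
  have abel1: "L \<bullet> abel [c] = L $ c" for c
  proof -
    have "abel [c] = axis c 1" by (auto simp: abel_def vec_eq_iff axis_def)
    then show ?thesis by (simp add: inner_axis)
  qed
  (* the size of the smallest letter *)
  define \<delta> where "\<delta> = Min (range (($) L))"
  have \<delta>: "0 < \<delta>" "\<And>c. \<delta> \<le> L $ c" by (auto simp: \<delta>_def L_pos)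
  obtain n where n: "L $ A 0 / \<delta> < lam ^ n" using real_arch_pow[OF lam(2)] by blast
  have "[A 0] \<in> subst_word_pow \<theta> (n - 0) [A n]"
    by (rule chain_subst_word_pow[of n "\<lambda>i. [A i]"]) (use z in auto)
  then have "L $ A 0 = lam ^ n * L $ A n" using inner_L_pow abel1 by fastforce
  moreover have "lam ^ n * \<delta> \<le> lam ^ n * L $ A n" using \<delta> lam(2) by (intro mult_left_mono) auto
  ultimately show False using n \<delta> by (simp add: field_simps)
qed

text \<open>
  A tower over a word \<open>u\<close> is a chain of \<open>n\<close> successive realisations, level \<open>n\<close> being \<open>u\<close> and level
  \<open>0\<close> a realisation of \<open>\<theta>\<^sup>n(u)\<close>.
\<close>
definition tower :: "nat \<Rightarrow> 'n list \<Rightarrow> (nat \<Rightarrow> 'n list) \<Rightarrow> bool" where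
  "tower n u t \<longleftrightarrow> t n = u \<and> (\<forall>m<n. t m \<in> subst_word \<theta> (t (Suc m)))"

text \<open>
  A tower serves the request \<open>(N, b, v)\<close>, where \<open>v\<close> is a realisation of
  \<open>\<theta>\<^sup>N(b)\<close>, if some occurrence of \<open>b\<close> on level \<open>N\<close> is realised by \<open>v\<close> on level \<open>0\<close>.
\<close>
definition hits :: "nat \<Rightarrow> nat \<times> 'n \<times> 'n list \<Rightarrow> (nat \<Rightarrow> 'n list) \<Rightarrow> bool" where
  "hits n r t \<longleftrightarrow> (case r of (N, b, v) \<Rightarrow> N \<le> n \<and>
     (\<exists>q s q' s'. t N = q @ [b] @ s \<and> t 0 = q' @ v @ s' \<and> q' \<in> subst_word_pow \<theta> N q))"

lemma tower_exists: "\<exists>t. tower n u t"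
proof -
  obtain w where "w \<in> subst_word_pow \<theta> n u" using subst_word_pow_nonempty[OF rs] by blast
  then show ?thesis using subst_word_pow_chain unfolding tower_def by blast
qed

text \<open>
  Far enough above level \<open>N\<close>, every non-empty word has \<open>b\<close> among its descendants on level \<open>N\<close>, and its
  realisation on the levels below can be chosen freely.
\<close>
lemma hitting_tower_exists:
  "\<exists>K. \<forall>n N b v u. N + K \<le> n \<longrightarrow> v \<in> subst_word_pow \<theta> N [b] \<longrightarrow> u \<noteq> [] \<longrightarrow>
     (\<exists>t. tower n u t \<and> hits n (N, b, v) t)"
proof -
  obtain K where K: "\<And>n a b v. K \<le> n \<Longrightarrow> v \<in> subst_word_pow \<theta> n [a] \<Longrightarrow> b \<in> set v"
    using eventually_all_letters by blast
  have "\<exists>t. tower n u t \<and> hits n (N, b, v) t"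
    if n: "N + K \<le> n" and v: "v \<in> subst_word_pow \<theta> N [b]" and u: "u \<noteq> []" for n N b v u
  proof -
    obtain c u' where u': "u = [c] @ u'" using u by (cases u) auto
    obtain z zs where z: "z \<in> subst_word_pow \<theta> (n - N) [c]" "zs \<in> subst_word_pow \<theta> (n - N) u'"
      using subst_word_pow_nonempty[OF rs] by blast
    have "b \<in> set z" using K[of "n - N" z c b] z(1) n by simp
    then obtain q s where qs: "z = q @ [b] @ s" by (auto simp: in_set_conv_decomp)
    obtain q' s' where q's': "q' \<in> subst_word_pow \<theta> N q" "s' \<in> subst_word_pow \<theta> N (s @ zs)"
      using subst_word_pow_nonempty[OF rs] by blast
    have "q' @ v @ s' \<in> subst_word_pow \<theta> N (q @ [b] @ s @ zs)"
      using q's' v by (intro subst_word_pow_appendI)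
    then obtain t1 where t1: "t1 0 = q' @ v @ s'" "t1 N = q @ [b] @ s @ zs"
      "\<And>i. i < N \<Longrightarrow> t1 i \<in> subst_word \<theta> (t1 (Suc i))"
      using subst_word_pow_chain by metis
    have "z @ zs \<in> subst_word_pow \<theta> (n - N) u" unfolding u' using z by (intro subst_word_pow_appendI)
    then obtain t2 where t2: "t2 0 = z @ zs" "t2 (n - N) = u"
      "\<And>i. i < n - N \<Longrightarrow> t2 i \<in> subst_word \<theta> (t2 (Suc i))"
      using subst_word_pow_chain by metis
    define t where "t m = (if m \<le> N then t1 m else t2 (m - N))" for m
    have tN: "t m = t2 (m - N)" if "N \<le> m" for m using that t1(2) t2(1) qs by (auto simp: t_def)
    have "t m \<in> subst_word \<theta> (t (Suc m))" if "m < n" for m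
    proof (cases "m < N")
      case True
      then show ?thesis using t1(3) by (simp add: t_def)
    next
      case False
      then show ?thesis using t2(3)[of "m - N"] that by (simp add: tN Suc_diff_le)
    qed
    then have "tower n u t" unfolding tower_def using tN[of n] n t2(2) by simp
    moreover have "hits n (N, b, v) t" unfolding hits_def using n t1 q's'(1) by (auto simp: t_def)
    ultimately show ?thesis by blast
  qed
  then show ?thesis by blast
qed

lemma subst_seq_tower_subshift_inf:
  assumes "\<And>m. x m \<in> subshift \<theta>" and "\<And>m. x m \<in> subst_seq \<theta> (x (Suc m))"
  shows "x m \<in> subshift_inf \<theta>"
proof -
  have "x m \<in> (subst_seqs \<theta> ^^ n) (subshift \<theta>)" for n
    by (induction n arbitrary: m) (use assms in \<open>auto simp: subst_seqs_def\<close>)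
  then show ?thesis by (simp add: subshift_inf_def)
qed

text \<open>
  For a fixed choice of realisations, the map from a letter to the first letter of its realisation
  has a periodic orbit, and running backwards along it gives letters \<open>A m\<close> for all levels \<open>m\<close>. The rest
  \<open>u m\<close> of the realisation cannot be empty from some level on, by \<open>not_all_images_letters\<close>.
\<close>
lemma backward_letter_chain:
  "\<exists>A u. (\<forall>m. A m # u m \<in> \<theta> (A (Suc m))) \<and> (\<forall>N. \<exists>n\<ge>N. u n \<noteq> [])"
proof -
  define g where "g b = (SOME v. v \<in> \<theta> b)" for b
  have g: "g b \<in> \<theta> b" for b
    using rs unfolding g_def random_substitution_def by (simp add: some_in_eq)
  have g0: "g b \<noteq> []" for b using g[of b] rs unfolding random_substitution_def by metis
  obtain a k where k: "0 < k" "((\<lambda>b. hd (g b)) ^^ k) a = a" using periodic_point_exists by blast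
  (* k * m - m = - m modulo the period k, so increasing m means going one step back *)
  define A where "A m = ((\<lambda>b. hd (g b)) ^^ (k * m - m)) a" for m
  have A: "hd (g (A (Suc m))) = A m" for m
  proof -
    have "Suc (k * Suc m - Suc m) = (k * m - m) + k" using k(1)
      by (cases k) (simp_all add: algebra_simps)
    then have "hd (g (A (Suc m))) = ((\<lambda>b. hd (g b)) ^^ ((k * m - m) + k)) a"
      unfolding A_def by (metis comp_apply funpow.simps(2))
    then show ?thesis by (simp add: funpow_add k(2) A_def)
  qed
  define u where "u m = tl (g (A (Suc m)))" for m
  have Au: "A m # u m = g (A (Suc m))" for m using A[of m] g0 unfolding u_def by (metis list.collapse)
  have "\<exists>n\<ge>N. u n \<noteq> []" for N
  proof (rule ccontr)
    assume "\<not> ?thesis"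
    then have "[A (N + i)] \<in> \<theta> (A (N + Suc i))" for i
      using Au[of "N + i"] g[of "A (Suc (N + i))"] by simp
    then show False using not_all_images_letters[of "\<lambda>i. A (N + i)"] by simp
  qed
  then show ?thesis by (intro exI[of _ A] exI[of _ u]) (simp add: Au g)
qed

text \<open>
  The idea is to build all the preimages of \<open>w\<close> simultaneously. With the letters \<open>A m\<close> and the
  words \<open>u m\<close> of \<open>backward_letter_chain\<close> choose a tower \<open>T n\<close> over \<open>u n\<close> for each \<open>n\<close>. Let \<open>x m\<close>
  be the concatenation of \<open>A m\<close>, \<open>T m m\<close>, \<open>T (m + 1) m\<close>, \<open>T (m + 2) m\<close> and so on.
  Then \<open>x m \<in> \<theta>(x (m + 1))\<close>, since \<open>A m # u m\<close> realises the letter \<open>A (m + 1)\<close> and level \<open>m\<close> of a tower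
  realises level \<open>m + 1\<close>. Arbitrarily long prefixes of \<open>x m\<close> are realisations of iterates of
  letters \<open>A n\<close>, so all its subwords are legal. So all \<open>x m\<close> lie in \<open>X\<^sub>\<theta>\<^sup>\<infinity>\<close>. The towers are free, hence
  each request can be served by infinitely many of them, and what precedes the requested word in \<open>x 0\<close>
  is a realisation of \<open>\<theta>\<^sup>N\<close> of what precedes \<open>b\<close> in \<open>x N\<close>.
\<close>
lemma seed_exists:
  "\<exists>w x. w \<in> subshift_inf \<theta> \<and> x \<in> subshift_inf \<theta> \<and> w \<in> subst_seq \<theta> x \<and>
     (\<forall>N b v. v \<in> subst_word_pow \<theta> N [b] \<longrightarrow>
        (\<exists>q q' l. legal \<theta> q \<and> q' \<in> subst_word_pow \<theta> N q \<and> map w [0..<l] = q' @ v))"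
proof -
  obtain A u where Au: "\<And>m. A m # u m \<in> \<theta> (A (Suc m))" and u_inf: "\<And>N. \<exists>n\<ge>N. u n \<noteq> []"
    using backward_letter_chain by blast
  define G where "G = {n. u n \<noteq> []}"
  have "infinite G" unfolding infinite_nat_iff_unbounded_le using u_inf by (auto simp: G_def)
  then obtain r :: "nat \<Rightarrow> nat \<times> 'n \<times> 'n list" where r: "\<And>x N. \<exists>n\<in>G. N \<le> n \<and> r n = x"
    using infinitely_recurrent_enumeration by metis
  have "\<exists>t. tower n (u n) t \<and> ((\<exists>t'. tower n (u n) t' \<and> hits n (r n) t') \<longrightarrow> hits n (r n) t)" for n
    using tower_exists by blast
  then obtain T where T: "\<And>n. tower n (u n) (T n)"
    and hit: "\<And>n t'. tower n (u n) t' \<Longrightarrow> hits n (r n) t' \<Longrightarrow> hits n (r n) (T n)" by metis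
  define P where "P m n = A m # concat (map (\<lambda>i. T i m) [m..<n])" for m n
  have P_refl: "P m m = [A m]" for m by (simp add: P_def)
  have P_Suc: "P m (Suc n) = P m n @ T n m" if "m \<le> n" for m n using that by (simp add: P_def)
  have T_step: "T n m \<in> subst_word \<theta> (T n (Suc m))" if "m < n" for m n
    using T[of n] that by (simp add: tower_def)
  have T_top: "T n n = u n" for n using T[of n] by (simp add: tower_def)
  have P_step: "P m n \<in> subst_word \<theta> (P (Suc m) n)" if "Suc m \<le> n" for m n
    using that
  proof (induction rule: dec_induct)
    case base
    then show ?case using Au[of m] by (simp add: P_refl P_Suc T_top)
  next
    case (step n)
    then show ?case using T_step[of m n] by (simp add: P_Suc subst_word_appendI)
  qed
  have P_pow: "P m n \<in> subst_word_pow \<theta> (j - m) (P j n)" if "m \<le> j" "j \<le> n" for m j n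
    by (rule chain_subst_word_pow[of n "\<lambda>i. P i n"]) (use P_step that in auto)
  have P_legal: "legal \<theta> (P m n)" if "m \<le> n" for m n
    using legal_pow_letter P_pow[OF that order.refl] by (metis P_refl)
  have T_pow: "T n m \<in> subst_word_pow \<theta> (n - m) (u n)" if "m \<le> n" for m n
    using chain_subst_word_pow[of n "T n" \<theta> m n] T_step that by (simp add: T_top)
  have unb: "\<exists>n. i < length (P m (m + n))" for i m
  proof (induction i)
    case 0
    show ?case by (simp add: P_def)
  next
    case (Suc i)
    then obtain n where n: "i < length (P m (m + n))" by blast
    obtain k where k: "m + n \<le> k" "u k \<noteq> []" using u_inf by blast
    have "length (P m (m + n)) \<le> length (P m k)"
      using k(1) by (induction rule: dec_induct) (auto simp: P_Suc)
    moreover have "T k m \<noteq> []" using length_subst_word_pow[OF rs T_pow[of m k]] k by auto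
    ultimately have "Suc i < length (P m (Suc k))" using n k(1) by (cases "T k m") (auto simp: P_Suc)
    then show ?case using k(1) by (metis add_Suc_right le_add_diff_inverse le_add1 order_trans)
  qed
  have "\<exists>x. \<forall>n. map x [0..<length (P m (m + n))] = P m (m + n)" for m
    by (rule prefix_chain_limit) (auto simp: P_Suc unb)
  then obtain x where x': "\<And>m n. map (x m) [0..<length (P m (m + n))] = P m (m + n)" by metis
  have x: "map (x m) [0..<length (P m n)] = P m n" if "m \<le> n" for m n
    using x'[of m "n - m"] that by simp
  have subs: "x m \<in> subst_seq \<theta> (x (Suc m))" for m
  proof (rule subst_seq_limit)
    let ?W = "\<lambda>n. P m (Suc m + n)" and ?Z = "\<lambda>n. P (Suc m) (Suc m + n)"
    show "?W 0 \<in> subst_word \<theta> (?Z 0)" by (rule P_step) simp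
    show "\<exists>w z. ?W (Suc n) = ?W n @ w \<and> ?Z (Suc n) = ?Z n @ z \<and> w \<in> subst_word \<theta> z" for n
      using T_step[of m "Suc m + n"] P_Suc[of m "Suc m + n"] P_Suc[of "Suc m" "Suc m + n"] by auto
    show "map (x m) [0..<length (?W n)] = ?W n" for n by (rule x) simp
    show "map (x (Suc m)) [0..<length (?Z n)] = ?Z n" for n by (rule x) simp
    show "\<exists>n. i < length (?Z n)" for i by (rule unb)
  qed
  have sub: "x m \<in> subshift \<theta>" for m
    unfolding subshift_def
  proof (intro CollectI allI)
    fix i j
    obtain n where n: "j < length (P m (m + n))" using unb by blast
    have "map (x m) [i..<j] = drop i (take j (P m (m + n)))"
      using n by (subst x'[symmetric]) (simp add: take_map drop_map take_upt drop_upt)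
    then have "sublist (map (x m) [i..<j]) (P m (m + n))"
      by (metis sublist_drop sublist_take sublist_order.order_trans)
    then show "legal \<theta> (map (x m) [i..<j])" using P_legal[of m "m + n"] legal_sublist by auto
  qed
  have inf: "x m \<in> subshift_inf \<theta>" for m 
    by (rule subst_seq_tower_subshift_inf[of x, OF sub subs])
  have "\<exists>q q' l. legal \<theta> q \<and> q' \<in> subst_word_pow \<theta> N q \<and> map (x 0) [0..<l] = q' @ v"
    if v: "v \<in> subst_word_pow \<theta> N [b]" for N b v
  proof -
    obtain K where K: "\<And>n N b v u. N + K \<le> n \<Longrightarrow> v \<in> subst_word_pow \<theta> N [b] \<Longrightarrow> u \<noteq> [] \<Longrightarrow>
      (\<exists>t. tower n u t \<and> hits n (N, b, v) t)" using hitting_tower_exists by metis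
    obtain n where n: "n \<in> G" "N + K \<le> n" "r n = (N, b, v)" using r by blast
    have "hits n (N, b, v) (T n)" using K[OF n(2) v, of "u n"] hit[of n] n by (auto simp: G_def)
    then obtain q s q' s' where h: "T n N = q @ [b] @ s" "T n 0 = q' @ v @ s'" "q' \<in> subst_word_pow \<theta> N q"
      by (auto simp: hits_def)
    have Nn: "N \<le> n" using n(2) by simp
    (* what precedes b on level N is a prefix of a legal word, hence legal *)
    have "P N (Suc n) = (P N n @ q) @ [b] @ s" using P_Suc[OF Nn] h(1) by simp
    then have "legal \<theta> (P N n @ q)"
      using P_legal[of N "Suc n"] Nn legal_sublist by (metis le_SucI prefixI prefix_imp_sublist)
    moreover have "P 0 n @ q' \<in> subst_word_pow \<theta> N (P N n @ q)"
      using P_pow[of 0 N n] Nn h(3) by (intro subst_word_pow_appendI) simp_all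
    moreover have "P 0 (Suc n) = ((P 0 n @ q') @ v) @ s'" using P_Suc[of 0 n] h(2) by simp
    then have "prefix ((P 0 n @ q') @ v) (map (x 0) [0..<length (P 0 (Suc n))])"
      using x[of 0 "Suc n"] by (metis le0 prefixI)
    then have "map (x 0) [0..<length ((P 0 n @ q') @ v)] = (P 0 n @ q') @ v" by (rule prefix_map_upt)
    ultimately show ?thesis by blast
  qed
  then show ?thesis using inf subs by blast
qed

end

section \<open>Density of shift orbits\<close>

lemma open_cylinder: "openin seq_topology {y. \<forall>i<N. y i = x i}"
proof -
  have "openin seq_topology (\<Pi>\<^sub>E i\<in>UNIV. if i < N then {x i} else UNIV)"
    unfolding seq_topology_def
  proof (rule product_topology_basis)
    show "finite {i. (if i < N then {x i} else UNIV) \<noteq> topspace (discrete_topology UNIV)}"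
      by (rule finite_subset[of _ "{..<N}"]) (auto split: if_splits)
  qed simp
  also have "(\<Pi>\<^sub>E i\<in>UNIV. if i < N then {x i} else UNIV) = {y. \<forall>i<N. y i = x i}"
    by (force simp: PiE_UNIV_domain Pi_iff split: if_splits)
  finally show ?thesis .
qed

lemma in_closure_of_shift_orbit_iff:
  "x \<in> seq_topology closure_of (shift_orbit w) \<longleftrightarrow> (\<forall>N. \<exists>j. \<forall>i<N. w (j + i) = x i)"
proof
  assume x: "x \<in> seq_topology closure_of (shift_orbit w)"
  show "\<forall>N. \<exists>j. \<forall>i<N. w (j + i) = x i"
  proof
    fix N
    have "\<And>U. x \<in> U \<Longrightarrow> openin seq_topology U \<Longrightarrow> \<exists>y. y \<in> shift_orbit w \<and> y \<in> U"
      using x by (simp add: in_closure_of)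
    from this[OF _ open_cylinder[of N x]] obtain y
      where "y \<in> shift_orbit w" "y \<in> {y. \<forall>i<N. y i = x i}" by auto
    then show "\<exists>j. \<forall>i<N. w (j + i) = x i" by (auto simp: shift_orbit_def)
  qed
next
  assume N: "\<forall>N. \<exists>j. \<forall>i<N. w (j + i) = x i"
  show "x \<in> seq_topology closure_of (shift_orbit w)"
    unfolding in_closure_of
  proof (intro conjI allI impI)
    show "x \<in> topspace seq_topology" by (simp add: seq_topology_def)
    fix U assume U: "x \<in> U \<and> openin seq_topology U"
    then obtain X where X: "x \<in> (\<Pi>\<^sub>E i\<in>UNIV. X i)" "(\<Pi>\<^sub>E i\<in>UNIV. X i) \<subseteq> U"
      "finite {i. X i \<noteq> topspace (discrete_topology (UNIV :: 'a set))}"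
      using product_topology_open_contains_basis[of "\<lambda>_. discrete_topology UNIV" UNIV U x]
      unfolding seq_topology_def by blast
    then obtain n where n: "{i. X i \<noteq> UNIV} \<subseteq> {..<n}" using finite_nat_iff_bounded by auto
    obtain j where j: "\<forall>i<n. w (j + i) = x i" using N by blast
    have "w (j + i) \<in> X i" for i
    proof (cases "i < n")
      case True
      then show ?thesis using X(1) j by (auto simp: PiE_iff)
    next
      case False
      then have "X i = UNIV" using n by auto
      then show ?thesis by simp
    qed
    then have "(\<lambda>i. w (j + i)) \<in> U" using X(2) by (auto simp: PiE_iff)
    then show "\<exists>y. y \<in> shift_orbit w \<and> y \<in> U" unfolding shift_orbit_def by blast
  qed
qed

context pisot_substitution
begin

section \<open>Tiles of sequences and iterated subdivision\<close>

lemma seq_subtile_eq: "seq_subtile L R w a = closure {pt (map w [0..<n]) |n. w n = a}"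
proof -
  have "proj L R ` prefix_points w a = {pt (map w [0..<n]) |n. w n = a}"
    unfolding prefix_points_def pt_def by auto
  then show ?thesis by (simp add: seq_subtile_def)
qed

text \<open>
  The common bounded family in which all iterations start: it contains the tiles of every element
  of the subshift.
\<close>
definition trap :: "'n \<Rightarrow> (real ^ 'n) set" where
  "trap a = hyperplane L \<inter> cball 0 discrepancy"

lemma compact_trap: "compact (trap a)"
proof -
  have "closed (hyperplane L)" unfolding hyperplane_def by (rule closed_hyperplane)
  then show ?thesis unfolding trap_def by (rule closed_Int_compact) simp
qed

lemma seq_subtile_subset_trap:
  assumes "w \<in> subshift \<theta>"
  shows "seq_subtile L R w a \<subseteq> trap a"
  unfolding seq_subtile_eq
proof (rule closure_minimal)
  show "closed (trap a)" by (rule compact_imp_closed[OF compact_trap])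
  show "{pt (map w [0..<n]) |n. w n = a} \<subseteq> trap a"
    using assms by (auto simp: trap_def hyperplane_def subshift_def norm_pt_legal)
qed

lemma seq_subtile_subst_seq:
  assumes y: "y \<in> subst_seq \<theta> x" and cpt: "\<And>b. compact (seq_subtile L R x b)"
  shows "seq_subtile L R y \<le> subdivide (seq_subtile L R x)"
proof (rule le_funI)
  fix a
  show "seq_subtile L R y a \<subseteq> subdivide (seq_subtile L R x) a"
    unfolding seq_subtile_eq[of y]
  proof (rule closure_minimal)
    show "closed (subdivide (seq_subtile L R x) a)" by (rule compact_imp_closed[OF compact_subdivide[OF cpt]])
    show "{pt (map y [0..<n]) |n. y n = a} \<subseteq> subdivide (seq_subtile L R x) a"
    proof clarify
      fix n
      obtain m q p s where d: "map y [0..<n] = q @ p" "q \<in> subst_word \<theta> (map x [0..<m])"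
        "p @ [y n] @ s \<in> \<theta> (x m)" using subst_seq_prefix_ancestor[OF rs y] by blast
      have "pt (map x [0..<m]) \<in> seq_subtile L R x (x m)"
        unfolding seq_subtile_eq by (rule subsetD[OF closure_subset]) blast
      from subdivide_I[where T = "seq_subtile L R x", OF d(3) this] show "pt (map y [0..<n]) \<in> subdivide (seq_subtile L R x) (y n)"
        by (simp add: d(1) pt_subst_word[OF d(2)])
    qed
  qed
qed

lemma compact_seq_subtile:
  assumes "compact S" "seq_subtile L R w a \<subseteq> S"
  shows "compact (seq_subtile L R w a)"
  using compact_Int_closed[OF assms(1), of "seq_subtile L R w a"] assms(2)
  by (simp add: seq_subtile_def Int_absorb1)

lemma seq_subtile_le_iterate:
  "w \<in> (subst_seqs \<theta> ^^ n) (subshift \<theta>) \<Longrightarrow> seq_subtile L R w \<le> (subdivide ^^ n) trap"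
proof (induction n arbitrary: w)
  case 0
  then show ?case by (auto simp: le_fun_def intro: subsetD[OF seq_subtile_subset_trap])
next
  case (Suc n)
  have "w \<in> subst_seqs \<theta> X \<longleftrightarrow> (\<exists>x\<in>X. w \<in> subst_seq \<theta> x)" for X by (simp add: subst_seqs_def)
  then obtain x where x: "x \<in> (subst_seqs \<theta> ^^ n) (subshift \<theta>)" "w \<in> subst_seq \<theta> x"
    using Suc.prems by auto
  have le: "seq_subtile L R x \<le> (subdivide ^^ n) trap" by (rule Suc.IH[OF x(1)])
  have "compact (seq_subtile L R x b)" for b
  proof (rule compact_seq_subtile)
    show "compact ((subdivide ^^ n) trap b)" by (rule compact_subdivide_iter[OF compact_trap])
    show "seq_subtile L R x b \<subseteq> (subdivide ^^ n) trap b" using le by (simp add: le_fun_def)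
  qed
  then have "seq_subtile L R w \<le> subdivide (seq_subtile L R x)" by (rule seq_subtile_subst_seq[OF x(2)])
  also have "\<dots> \<le> subdivide ((subdivide ^^ n) trap)" by (rule subdivide_mono[OF le])
  finally show ?case by simp
qed

lemma contracting_approximation_in_closure:
  assumes "\<And>n. \<exists>z'\<in>S. \<exists>d. L \<bullet> d = 0 \<and> norm d \<le> c \<and> z - z' = Mpow (Suc n) d"
  shows "z \<in> closure S"
  unfolding closure_approachable
proof (intro allI impI)
  fix e :: real assume e: "0 < e"
  have "(\<lambda>n. contraction (Suc n) * c) \<longlonglongrightarrow> 0 * c"
    by (intro tendsto_mult tendsto_const LIMSEQ_Suc[OF contraction_tendsto_0])
  then have "\<forall>\<^sub>F n in sequentially. contraction (Suc n) * c < e" using e order_tendstoD(2) by fastforce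
  then obtain n where n: "contraction (Suc n) * c < e" by (auto simp: eventually_sequentially)
  obtain z' d where z': "z' \<in> S" "L \<bullet> d = 0" "norm d \<le> c" "z - z' = Mpow (Suc n) d"
    using assms by blast
  have "dist z' z = norm (Mpow (Suc n) d)" by (simp add: z'(4)[symmetric] dist_norm norm_minus_commute)
  also have "\<dots> \<le> contraction (Suc n) * norm d" by (rule norm_Mpow_le[OF z'(2)])
  also have "\<dots> \<le> contraction (Suc n) * c" by (intro mult_left_mono z' contraction_nonneg)
  finally show "\<exists>y\<in>S. dist y z < e" using n z'(1) by (meson order.strict_trans1)
qed

text \<open>
  The property of the sequence constructed in \<open>seed_exists\<close>: every realisation of an iterate of a
  letter occurs behind a prefix with a short projection.
\<close>
definition seed :: "(nat \<Rightarrow> 'n) \<Rightarrow> bool" where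
  "seed w \<longleftrightarrow> (\<forall>N b v. v \<in> subst_word_pow \<theta> N [b] \<longrightarrow>
     (\<exists>q q' l. legal \<theta> q \<and> q' \<in> subst_word_pow \<theta> N q \<and> map w [0..<l] = q' @ v))"

lemma map_upt_append_nth:
  assumes "map w [0..<l] = p @ a # s"
  shows "map w [0..<length p] = p" "w (length p) = a"
proof -
  have l: "l = length p + Suc (length s)" using arg_cong[OF assms, of length] by simp
  have "take (length p) (map w [0..<l]) = p" using assms by simp
  then show "map w [0..<length p] = p" by (simp add: l take_map take_upt)
  have "map w [0..<l] ! length p = a" using assms by simp
  then show "w (length p) = a" by (simp add: l del: upt_Suc)
qed

text \<open>
  A point of \<open>A a\<close> has the form \<open>M\<^sup>n y + pt p\<close> with \<open>p a s \<in> \<theta>\<^sup>n(b)\<close>. In a seed the word \<open>p a s\<close> occurs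
  behind a realisation of \<open>\<theta>\<^sup>n(q)\<close>, which yields the point \<open>M\<^sup>n (pt q) + pt p\<close> of the tile of \<open>w\<close>. Both
  points differ by \<open>M\<^sup>n\<close> of a bounded vector.
\<close>
lemma seed_dominates:
  assumes seed: "seed w" and A: "\<And>n. A \<le> (subdivide ^^ Suc n) (B n)"
    and B: "\<And>n b. B n b \<subseteq> hyperplane L \<inter> cball 0 r"
  shows "A \<le> seq_subtile L R w"
proof (rule le_funI, rule subsetI)
  fix a z assume z: "z \<in> A a"
  show "z \<in> seq_subtile L R w a" unfolding seq_subtile_eq
  proof (rule contracting_approximation_in_closure)
    fix n
    have "z \<in> (subdivide ^^ Suc n) (B n) a" using A[of n] z by (auto simp: le_fun_def)
    then obtain b p s y where d: "p @ [a] @ s \<in> subst_word_pow \<theta> (Suc n) [b]" "y \<in> B n b"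
      "z = Mpow (Suc n) y + pt p" unfolding subdivide_iter_iff by blast
    obtain q q' l where q: "legal \<theta> q" "q' \<in> subst_word_pow \<theta> (Suc n) q" "map w [0..<l] = q' @ p @ [a] @ s"
      using seed d(1) unfolding seed_def by blast
    have "map w [0..<length (q' @ p)] = q' @ p" "w (length (q' @ p)) = a"
      using map_upt_append_nth[of w l "q' @ p" a s] q(3) by simp_all
    then have "pt (q' @ p) \<in> {pt (map w [0..<n]) |n. w n = a}" by (metis (mono_tags, lifting) mem_Collect_eq)
    moreover have "L \<bullet> (y - pt q) = 0" "norm (y - pt q) \<le> r + discrepancy"
      using B[of n b] d(2) norm_pt_legal[OF q(1)] norm_triangle_ineq4[of y "pt q"]
      by (auto simp: hyperplane_def inner_diff_right subset_iff)
    moreover have "z - pt (q' @ p) = Mpow (Suc n) (y - pt q)"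
      by (simp add: d(3) pt_pow[OF q(2)] linear_diff[OF linear_Mpow])
    ultimately show "\<exists>z'\<in>{pt (map w [0..<n]) |n. w n = a}. \<exists>d. L \<bullet> d = 0 \<and>
        norm d \<le> r + discrepancy \<and> z - z' = Mpow (Suc n) d" by blast
  qed
qed

lemma seed_contains_legal:
  assumes "seed w" "legal \<theta> u"
  shows "\<exists>j. \<forall>i<length u. w (j + i) = u ! i"
proof -
  obtain N b v x y where v: "v \<in> subst_word_pow \<theta> N [b]" "v = x @ u @ y"
    using assms(2) unfolding legal_def sublist_def by blast
  obtain q' l where q': "map w [0..<l] = q' @ v" using assms(1) v(1) unfolding seed_def by blast
  have "w (length (q' @ x) + i) = u ! i" if "i < length u" for i
  proof -
    have l: "length (q' @ x) + i < l" using arg_cong[OF q', of length] that v(2) by simp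
    have "map w [0..<l] ! (length (q' @ x) + i) = ((q' @ x) @ u @ y) ! (length (q' @ x) + i)"
      using q' v(2) by simp
    also have "\<dots> = u ! i" using that by (simp only: nth_append_length_plus) (simp add: nth_append)
    finally show ?thesis using l by simp
  qed
  then show ?thesis by blast
qed

text \<open>
  A point of \<open>T a\<close> and a point of \<open>T' a\<close> that use the same \<open>p\<close> on level \<open>n\<close> differ only by \<open>M\<^sup>n\<close> of a bounded
  vector. The lemma gives one inclusion; equality follows by symmetry.
\<close>
lemma fixed_family_unique:
  assumes T: "compact_family L T" "subdivide T = T" and T': "compact_family L T'" "subdivide T' = T'"
  shows "T \<le> T'"
proof (rule le_funI, rule subsetI)
  fix a z assume z: "z \<in> T a"
  have fix_iter: "(subdivide ^^ n) T = T" "(subdivide ^^ n) T' = T'" for n by (induction n) (simp_all add: T T')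
  have "\<exists>r. \<forall>x\<in>(\<Union>b. S b). norm x \<le> r" if S: "compact_family L S" for S
  proof -
    have "bounded (\<Union>b. S b)" using S by (intro bounded_UN) (auto simp: compact_family_def intro: compact_imp_bounded)
    then show ?thesis by (simp add: bounded_iff)
  qed
  then obtain r r' where r: "\<And>b x. x \<in> T b \<Longrightarrow> norm x \<le> r" "\<And>b x. x \<in> T' b \<Longrightarrow> norm x \<le> r'"
    using T(1) T'(1) by (metis UN_I UNIV_I)
  have "z \<in> closure (T' a)"
  proof (rule contracting_approximation_in_closure)
    fix n
    have "z \<in> (subdivide ^^ Suc n) T a" using z by (simp only: fix_iter)
    then obtain b p s y where d: "p @ [a] @ s \<in> subst_word_pow \<theta> (Suc n) [b]" "y \<in> T b"
      "z = Mpow (Suc n) y + pt p" unfolding subdivide_iter_iff by blast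
    obtain y' where y': "y' \<in> T' b" using T'(1) by (auto simp: compact_family_def)
    have "Mpow (Suc n) y' + pt p \<in> (subdivide ^^ Suc n) T' a" unfolding subdivide_iter_iff using d(1) y' by blast
    then have "Mpow (Suc n) y' + pt p \<in> T' a" by (simp only: fix_iter)
    moreover have "L \<bullet> (y - y') = 0"
      using T(1) T'(1) d(2) y' by (auto simp: compact_family_def hyperplane_def inner_diff_right subset_iff)
    moreover have "norm (y - y') \<le> r + r'"
      using r(1)[OF d(2)] r(2)[OF y'] norm_triangle_ineq4[of y y'] by linarith
    moreover have "z - (Mpow (Suc n) y' + pt p) = Mpow (Suc n) (y - y')"
      by (simp add: d(3) linear_diff[OF linear_Mpow])
    ultimately show "\<exists>z'\<in>T' a. \<exists>d. L \<bullet> d = 0 \<and> norm d \<le> r + r' \<and> z - z' = Mpow (Suc n) d" by blast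
  qed
  moreover have "closed (T' a)" using T'(1) by (simp add: compact_family_def compact_imp_closed)
  ultimately show "z \<in> T' a" by (simp add: closure_closed)
qed

lemma bounded_translate_eq_0:
  fixes t :: "'a::real_normed_vector"
  assumes "bounded S" "z \<in> S" "\<And>x. x \<in> S \<Longrightarrow> t + x \<in> S"
  shows "t = 0"
proof (rule ccontr)
  assume t: "t \<noteq> 0"
  obtain r where r: "\<And>x. x \<in> S \<Longrightarrow> norm x \<le> r" using assms(1) by (auto simp: bounded_iff)
  have S: "real k *\<^sub>R t + z \<in> S" for k
    by (induction k) (use assms(2,3) in \<open>auto simp: scaleR_add_left add.assoc\<close>)
  obtain k where k: "2 * r < real k * norm t" using t reals_Archimedean3[of "norm t"] by auto
  have "norm (real k *\<^sub>R t) \<le> norm (real k *\<^sub>R t + z) + norm z"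
    using norm_triangle_ineq4[of "real k *\<^sub>R t + z" z] by simp
  then show False using r[OF S[of k]] r[OF assms(2)] k by simp
qed

text \<open>
  The prefixes of \<open>w0\<close> occur in \<open>w\<close> at positions whose projections \<open>\<tau> N\<close> are bounded, and \<open>t\<close> is a limit
  point of them. A point of the tile of \<open>w0\<close> that comes from a prefix of length \<open>n\<close> is seen, shifted by
  \<open>\<tau> N\<close>, in the tile of \<open>w\<close> for all \<open>N > n\<close>.
\<close>
lemma translate_of_subtile_in_generic:
  assumes w0: "w0 \<in> subshift \<theta>" and w: "w \<in> generic_seqs \<theta>"
  shows "\<exists>t. \<forall>a. \<forall>z\<in>seq_subtile L R w0 a. t + z \<in> seq_subtile L R w a"
proof -
  have wX: "w \<in> subshift \<theta>" using w by (auto simp: generic_seqs_def subshift_inf_def dest: spec[of _ 0])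
  have "w0 \<in> seq_topology closure_of (shift_orbit w)" using w0 w by (auto simp: generic_seqs_def)
  then obtain j where j: "\<And>N i. i < N \<Longrightarrow> w (j N + i) = w0 i"
    unfolding in_closure_of_shift_orbit_iff by metis
  define \<tau> where "\<tau> N = pt (map w [0..<j N])" for N
  have "bounded (range \<tau>)"
    unfolding bounded_iff using wX by (auto simp: \<tau>_def subshift_def intro!: exI[of _ discrepancy] norm_pt_legal)
  then obtain t \<rho> where t: "strict_mono \<rho>" "(\<tau> \<circ> \<rho>) \<longlonglongrightarrow> t"
    using bounded_imp_convergent_subsequence by blast
  have "t + z \<in> seq_subtile L R w a" if z: "z \<in> seq_subtile L R w0 a" for a z
  proof -
    have cl: "closed (seq_subtile L R w a)" by (simp add: seq_subtile_def)
    have pre: "t + pt (map w0 [0..<n]) \<in> seq_subtile L R w a" if n: "w0 n = a" for n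
    proof (rule Lim_in_closed_set[OF cl])
      show "((\<lambda>k. (\<tau> \<circ> \<rho>) k + pt (map w0 [0..<n])) \<longlongrightarrow> t + pt (map w0 [0..<n])) sequentially"
        by (intro tendsto_add tendsto_const t)
      have "(\<tau> \<circ> \<rho>) k + pt (map w0 [0..<n]) \<in> seq_subtile L R w a" if k: "n < k" for k
      proof -
        have k': "n < \<rho> k" using k strict_mono_imp_increasing[OF t(1), of k] by simp
        have "map w [0..<j (\<rho> k) + n] = map w [0..<j (\<rho> k)] @ map w0 [0..<n]"
        proof (rule nth_equalityI)
          fix i assume i: "i < length (map w [0..<j (\<rho> k) + n])"
          show "map w [0..<j (\<rho> k) + n] ! i = (map w [0..<j (\<rho> k)] @ map w0 [0..<n]) ! i"
            using i k' j[of "i - j (\<rho> k)" "\<rho> k"] by (auto simp: nth_append)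
        qed simp
        then have "(\<tau> \<circ> \<rho>) k + pt (map w0 [0..<n]) = pt (map w [0..<j (\<rho> k) + n])" by (simp add: \<tau>_def)
        moreover have "w (j (\<rho> k) + n) = a" using j[OF k'] n by simp
        ultimately show ?thesis unfolding seq_subtile_eq by (intro subsetD[OF closure_subset]) blast
      qed
      then show "\<forall>\<^sub>F k in sequentially. (\<tau> \<circ> \<rho>) k + pt (map w0 [0..<n]) \<in> seq_subtile L R w a"
        by (intro eventually_mono[OF eventually_gt_at_top[of n]])
    qed simp
    have "seq_subtile L R w0 a \<subseteq> (\<lambda>x. t + x) -` seq_subtile L R w a"
      unfolding seq_subtile_eq[of w0]
    proof (rule closure_minimal)
      show "closed ((\<lambda>x. t + x) -` seq_subtile L R w a)"
        by (intro closed_vimage cl continuous_intros)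
    qed (use pre in auto)
    then show ?thesis using z by blast
  qed
  then show ?thesis by blast
qed

theorem subtile_characterisation:
  "compact_family L (subtile \<theta> L R) \<and> self_consistent \<theta> L R (subtile \<theta> L R) \<and>
    (\<forall>T. compact_family L T \<and> self_consistent \<theta> L R T \<longrightarrow> T = subtile \<theta> L R)"
proof -
  obtain w x where w: "w \<in> subshift_inf \<theta>" and x: "x \<in> subshift_inf \<theta>" and wx: "w \<in> subst_seq \<theta> x"
    and seed: "seed w" using seed_exists unfolding seed_def by metis
  define T where "T = seq_subtile L R w"
  have iterate: "seq_subtile L R y \<le> (subdivide ^^ n) trap" if "y \<in> subshift_inf \<theta>" for y n
    using that seq_subtile_le_iterate by (auto simp: subshift_inf_def)
  have dominated: "A \<le> T" if "\<And>n. A \<le> (subdivide ^^ Suc n) trap" for A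
    unfolding T_def by (rule seed_dominates[OF seed that, where r = discrepancy]) (simp add: trap_def)
  have below_T: "seq_subtile L R y \<le> T" if "y \<in> subshift_inf \<theta>" for y
    using dominated iterate[OF that] by blast
  have cpt: "compact (seq_subtile L R y a)" "seq_subtile L R y a \<subseteq> trap a" if "y \<in> subshift_inf \<theta>" for y a
  proof -
    show sub: "seq_subtile L R y a \<subseteq> trap a" using iterate[OF that, of 0] by (simp add: le_fun_def)
    show "compact (seq_subtile L R y a)"
      by (rule compact_seq_subtile[OF compact_trap sub])
  qed
  have nonempty: "T a \<noteq> {}" for a
  proof -
    obtain q' l where "map w [0..<l] = q' @ [a]"
      using seed unfolding seed_def by (metis singletonI subst_word_pow.simps(1))
    then have "w (length q') = a" using map_upt_append_nth(2)[of w l q' a "[]"] by simp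
    then show ?thesis unfolding T_def seq_subtile_eq by auto
  qed
  have family: "compact_family L T"
    unfolding compact_family_def using nonempty cpt[OF w] by (auto simp: T_def trap_def)
  (* the subdivision of T lies in all iterates on the trap, because T does *)
  have "subdivide T \<le> T"
  proof (rule dominated)
    fix n
    have "subdivide T \<le> subdivide ((subdivide ^^ n) trap)" unfolding T_def by (intro subdivide_mono iterate w)
    then show "subdivide T \<le> (subdivide ^^ Suc n) trap" by simp
  qed
  (* w is an image of x, and the tiles of x are contained in those of w *)
  moreover have "T \<le> subdivide T"
  proof -
    have "T \<le> subdivide (seq_subtile L R x)" unfolding T_def by (rule seq_subtile_subst_seq[OF wx cpt(1)[OF x]])
    also have "\<dots> \<le> subdivide T" by (rule subdivide_mono[OF below_T[OF x]])
    finally show ?thesis .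
  qed
  ultimately have fixed: "subdivide T = T" by (rule order.antisym)
  have generic_w: "w \<in> generic_seqs \<theta>"
  proof -
    have "y \<in> seq_topology closure_of (shift_orbit w)" if y: "y \<in> subshift \<theta>" for y
      unfolding in_closure_of_shift_orbit_iff
    proof
      fix N
      have "legal \<theta> (map y [0..<N])" using y by (simp add: subshift_def)
      from seed_contains_legal[OF seed this] show "\<exists>j. \<forall>i<N. w (j + i) = y i" by simp
    qed
    then show ?thesis using w by (auto simp: generic_seqs_def)
  qed
  have indep: "seq_subtile L R y = T" if y: "y \<in> generic_seqs \<theta>" for y
  proof -
    have yi: "y \<in> subshift_inf \<theta>" using y by (simp add: generic_seqs_def)
    have "w \<in> subshift \<theta>" using w by (auto simp: subshift_inf_def dest: spec[of _ 0])
    then obtain t where t: "\<And>a z. z \<in> T a \<Longrightarrow> t + z \<in> seq_subtile L R y a"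
      using translate_of_subtile_in_generic y unfolding T_def by blast
    have "t = 0"
    proof (rule bounded_translate_eq_0)
      (* any letter will do here *)
      show "bounded (T undefined)" using family by (simp add: compact_family_def compact_imp_bounded)
      show "(SOME z. z \<in> T undefined) \<in> T undefined" using nonempty by (simp add: some_in_eq)
      show "t + z \<in> T undefined" if "z \<in> T undefined" for z
        using t[OF that] below_T[OF yi] by (auto simp: le_fun_def)
    qed
    then have "T \<le> seq_subtile L R y" using t by (auto simp: le_fun_def)
    then show ?thesis using below_T[OF yi] by (rule order.antisym[rotated])
  qed
  have "subtile \<theta> L R = T"
  proof
    fix a
    show "subtile \<theta> L R a = T a" unfolding subtile_def
    proof (rule the_equality)
      show "\<exists>y\<in>generic_seqs \<theta>. T a = seq_subtile L R y a" using generic_w T_def by metis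
      show "S = T a" if "\<exists>y\<in>generic_seqs \<theta>. S = seq_subtile L R y a" for S using that indep by metis
    qed
  qed
  moreover have "S = T" if "compact_family L S" "subdivide S = S" for S
    using fixed_family_unique that family fixed by (intro order.antisym) blast+
  ultimately show ?thesis using family fixed unfolding self_consistent_iff by metis
qed

end

section \<open>The self-consistency theorem\<close>

theorem theorem4p7:
  fixes \<theta> :: "'n::finite \<Rightarrow> 'n list set" and L R :: "real ^ 'n"
  assumes "random_substitution \<theta>"
    and "compatible \<theta>"
    and "irreducible_pisot \<theta>"
    and "left_pf_eigenvector (subst_matrix \<theta>) L"
    and "right_pf_eigenvector (subst_matrix \<theta>) R"
  shows "compact_family L (subtile \<theta> L R) \<and> self_consistent \<theta> L R (subtile \<theta> L R) \<and>
    (\<forall>T. compact_family L T \<and> self_consistent \<theta> L R T \<longrightarrow> T = subtile \<theta> L R)"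
proof -
  interpret pisot_substitution \<theta> L R
    by unfold_locales (fact assms)+
  show ?thesis by (rule subtile_characterisation)
qed

end
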